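(* Consider the rescaled equation $$\partial_Tu+6u\,\partial_Xu+\varepsilon^2\partial_X^3u+\delta(\varepsilon\,\partial_X^2u+\varepsilon^3\partial_X^4u)=0\qquad(\ast)$$ with $\delta>0$ fixed, and a formal solution $u=\sum_{j\ge0}\varepsilon^ju_j\big(\tfrac{\varphi(X,T)}{\varepsilon};X,T\big)$, $\varphi=\sum_{j\ge0}\varepsilon^j\varphi_j(X,T)$, with all $u_j(y;X,T)$, $\varphi_j(X,T)$ smooth and $u_j$ $1$-periodic in $y$. Set $k_0=\partial_X\varphi_0$, $M_0=\langle u_0\rangle$, $k_1=\partial_X\varphi_1$, $M_1=\langle u_1\rangle$, $\Omega(k,M)=-k\,c(k,M)$, and suppose $u_0=U(y;k_0,M_0)$ and $\partial_T\varphi_0=\Omega(k_0,M_0)$, where $(U,c)$ is the family of periodic travelling waves described in the context. If $(\ast)$ holds at orders $\varepsilon^0$ and $\varepsilon^1$, then, with $f_0(y;X,T)$ the unique function $1$-periodic in $y$ such that $\langle f_0\,U'(\cdot\,;k_0,M_0)\rangle=0$ and $$\begin{aligned}\mathcal{L}_{k_0,M_0}f_0=\ &\partial_Tu_0+\partial_X(3u_0^2)+3\big(k_0^2\partial_X\partial_y^2u_0+k_0\,\partial_Xk_0\,\partial_y^2u_0\big)\\&+\delta\big(2k_0\partial_X\partial_yu_0+\partial_Xk_0\,\partial_yu_0+4k_0^3\partial_X\partial_y^3u_0+6k_0^2\,\partial_Xk_0\,\partial_y^3u_0\big),\end{aligned}$$ the pair $(k_1,M_1)$ satisfies $$\partial_Tk_1-\partial_X\big(k_1\,\partial_k\Omega(k_0,M_0)+M_1\,\partial_M\Omega(k_0,M_0)\big)=-\partial_X\big(6k_0\langle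 f_0\rangle\big),$$ $$\partial_TM_1+\partial_X\big(k_1\,\partial_k\langle3U^2\rangle(k_0,M_0)+M_1\,\partial_M\langle3U^2\rangle(k_0,M_0)\big)=\partial_X\big\langle6u_0\,(f_0-\langle f_0\rangle)\big\rangle-\delta\,\partial_X^2M_0 .$$
   Context: $\langle f\rangle=\int_0^1 f(y)\,dy$ for $1$-periodic $f$. Formal solution: one substitutes $u=\sum_j\varepsilon^ju_j(y;X,T)$, replaces $\partial_X$ by $\partial_X+\varepsilon^{-1}(\partial_X\varphi)\partial_y$ and $\partial_T$ by $\partial_T+\varepsilon^{-1}(\partial_T\varphi)\partial_y$, and requires the resulting formal Laurent series in $\varepsilon$ to vanish for all $(y,X,T)$; "holds at order $\varepsilon^n$" means the coefficient of $\varepsilon^n$ vanishes. Travelling wave family: for $(k,M)$ in an open set with $k>0$, $U(\cdot\,;k,M)$ is a smooth non-constant $1$-periodic function and $c(k,M)\in\mathbb{R}$, both depending smoothly on $(k,M)$, with $\langle U\rangle=M$ and $$-kcU'+6kUU'+k^3U'''+\delta(k^2U''+k^4U'''')=0,$$ normalized so that $U(\cdot\,;k,M)=M+U^{(0)}(\cdot\,;k)$ and $c(k,M)=6M+c^{(0)}(k)$. Standing assumption: the operator on $1$-periodic functions $$\mathcal{L}_{k,M}f=k\big((6U-c)f\big)'+k^3f'''+\delta(k^2f''+k^4f'''')$$ has one-dimensional kernel spanned by $U'$; it is Fredholm of index $0$ and the kernel of its adjoint is spanned by the constant function $1$. *)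

theory Defs
  imports
    "HOL-Analysis.Analysis"
    "HOL-Computational_Algebra.Formal_Laurent_Series"
    "HOL-Library.Function_Algebras"
begin

section \<open>Smooth and periodic functions\<close>

text \<open>\<open>n\<close> times continuously differentiable on an open set, through directional derivatives.\<close>

fun higher_differentiable_on ::
    "nat \<Rightarrow> 'a::real_normed_vector set \<Rightarrow> ('a \<Rightarrow> 'b::real_normed_vector) \<Rightarrow> bool" where
  "higher_differentiable_on 0 S f \<longleftrightarrow> continuous_on S f"
| "higher_differentiable_on (Suc n) S f \<longleftrightarrow>
     (\<forall>x\<in>S. f differentiable (at x)) \<and>
     (\<forall>v. higher_differentiable_on n S (\<lambda>x. frechet_derivative f (at x) v))"

definition smooth_on :: "'a::real_normed_vector set \<Rightarrow> ('a \<Rightarrow> 'b::real_normed_vector) \<Rightarrow> bool" where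
  "smooth_on S f \<longleftrightarrow> (\<forall>n. higher_differentiable_on n S f)"

definition periodic1 :: "(real \<Rightarrow> real) \<Rightarrow> bool" where
  "periodic1 f \<longleftrightarrow> (\<forall>y. f (y + 1) = f y)"

definition C_per :: "nat \<Rightarrow> (real \<Rightarrow> real) set" where
  "C_per n = {f. periodic1 f \<and> higher_differentiable_on n UNIV f}"

definition avg :: "(real \<Rightarrow> real) \<Rightarrow> real" where
  "avg f = integral {0..1} f"


section \<open>Partial derivatives\<close>

text \<open>
  Functions of \<open>(X,T)\<close> and of \<open>(k,M)\<close> live on pairs, functions of \<open>(y;X,T)\<close> and of
  \<open>(y;k,M)\<close> on right-nested triples.  On triples \<open>pd1\<close> is the derivative in \<open>y\<close>, whereas
  \<open>slow pd1\<close> and \<open>slow pd2\<close> are the derivatives in \<open>X\<close> and \<open>T\<close> at fixed \<open>y\<close>.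
\<close>

definition pd1 :: "(real \<times> 'a \<Rightarrow> real) \<Rightarrow> real \<times> 'a \<Rightarrow> real" where
  "pd1 g = (\<lambda>(a, q). deriv (\<lambda>s. g (s, q)) a)"

definition pd2 :: "(real \<times> real \<Rightarrow> real) \<Rightarrow> real \<times> real \<Rightarrow> real" where
  "pd2 g = (\<lambda>(a, b). deriv (\<lambda>s. g (a, s)) b)"

definition slow :: "((real \<times> real \<Rightarrow> real) \<Rightarrow> real \<times> real \<Rightarrow> real)
    \<Rightarrow> (real \<times> real \<times> real \<Rightarrow> real) \<Rightarrow> real \<times> real \<times> real \<Rightarrow> real" where
  "slow d F = (\<lambda>(y, p). d (\<lambda>q. F (y, q)) p)"


section \<open>Formal solutions\<close>

text \<open>
  Formal Laurent series in \<open>\<epsilon>\<close> (the variable \<open>fls_X\<close>) whose coefficients are functions of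
  \<open>(y;X,T)\<close>, with the pointwise ring structure on the coefficients.
\<close>

type_synonym series = "(real \<times> real \<times> real \<Rightarrow> real) fls"

text \<open>Only used for operators with \<open>d 0 = 0\<close>, so that the result is again a Laurent series.\<close>

definition coeffwise :: "((real \<times> real \<times> real \<Rightarrow> real) \<Rightarrow> real \<times> real \<times> real \<Rightarrow> real)
    \<Rightarrow> series \<Rightarrow> series" where
  "coeffwise d F = Abs_fls (\<lambda>n. d (fls_nth F n))"

definition power_series :: "(nat \<Rightarrow> real \<times> real \<times> real \<Rightarrow> real) \<Rightarrow> series" where
  "power_series a = fps_to_fls (Abs_fps a)"

text \<open>
  For \<open>d = \<partial>\<^sub>X\<close> or \<open>d = \<partial>\<^sub>T\<close>: the operator \<open>d + \<epsilon>\<^sup>-\<^sup>1 (d \<phi>) \<partial>\<^sub>y\<close>, where \<open>\<phi> = \<Sum>\<^sub>j \<epsilon>\<^sup>j \<phi>\<^sub>j\<close>.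
\<close>

definition subst_deriv :: "((real \<times> real \<Rightarrow> real) \<Rightarrow> real \<times> real \<Rightarrow> real)
    \<Rightarrow> (nat \<Rightarrow> real \<times> real \<Rightarrow> real) \<Rightarrow> series \<Rightarrow> series" where
  "subst_deriv d \<phi> F =
     coeffwise (slow d) F
     + fls_X_inv * power_series (\<lambda>j. \<lambda>(y, p). d (\<phi> j) p) * coeffwise pd1 F"

definition residual :: "real \<Rightarrow> (nat \<Rightarrow> real \<times> real \<times> real \<Rightarrow> real)
    \<Rightarrow> (nat \<Rightarrow> real \<times> real \<Rightarrow> real) \<Rightarrow> series" where
  "residual \<delta> u \<phi> =
    (let w = power_series u; DX = subst_deriv pd1 \<phi>; DT = subst_deriv pd2 \<phi> in
       DT w + 6 * w * DX w + fls_X ^ 2 * (DX ^^ 3) w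
       + fls_const (\<lambda>_. \<delta>) * (fls_X * (DX ^^ 2) w + fls_X ^ 3 * (DX ^^ 4) w))"

definition holds_at_order :: "(real \<times> real) set \<Rightarrow> real \<Rightarrow> (nat \<Rightarrow> real \<times> real \<times> real \<Rightarrow> real)
    \<Rightarrow> (nat \<Rightarrow> real \<times> real \<Rightarrow> real) \<Rightarrow> int \<Rightarrow> bool" where
  "holds_at_order D \<delta> u \<phi> n \<longleftrightarrow> (\<forall>y. \<forall>p\<in>D. fls_nth (residual \<delta> u \<phi>) n (y, p) = 0)"


section \<open>Travelling waves and the linearized operator\<close>

definition travelling_wave_family :: "real \<Rightarrow> (real \<times> real) set
    \<Rightarrow> (real \<times> real \<times> real \<Rightarrow> real) \<Rightarrow> (real \<times> real \<Rightarrow> real) \<Rightarrow> bool" where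
  "travelling_wave_family \<delta> P U c \<longleftrightarrow>
     open P \<and> (\<forall>(k, M)\<in>P. k > 0) \<and>
     smooth_on (UNIV \<times> P) U \<and> smooth_on P c \<and>
     (\<forall>(k, M)\<in>P. let V = (\<lambda>y. U (y, k, M)) in
        periodic1 V \<and> \<not> V constant_on UNIV \<and> avg V = M \<and>
        (\<forall>y. - k * c (k, M) * deriv V y + 6 * k * V y * deriv V y + k ^ 3 * (deriv ^^ 3) V y
             + \<delta> * (k ^ 2 * (deriv ^^ 2) V y + k ^ 4 * (deriv ^^ 4) V y) = 0)) \<and>
     (\<exists>U0 c0. \<forall>(k, M)\<in>P. (\<forall>y. U (y, k, M) = M + U0 y k) \<and> c (k, M) = 6 * M + c0 k)"

definition lin_op :: "real \<Rightarrow> (real \<times> real \<times> real \<Rightarrow> real) \<Rightarrow> (real \<times> real \<Rightarrow> real)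
    \<Rightarrow> real \<times> real \<Rightarrow> (real \<Rightarrow> real) \<Rightarrow> real \<Rightarrow> real" where
  "lin_op \<delta> U c = (\<lambda>(k, M) f y.
     k * deriv (\<lambda>s. (6 * U (s, k, M) - c (k, M)) * f s) y + k ^ 3 * (deriv ^^ 3) f y
     + \<delta> * (k ^ 2 * (deriv ^^ 2) f y + k ^ 4 * (deriv ^^ 4) f y))"

definition kernel_on :: "(real \<Rightarrow> real) set \<Rightarrow> ((real \<Rightarrow> real) \<Rightarrow> real \<Rightarrow> real)
    \<Rightarrow> (real \<Rightarrow> real) set" where
  "kernel_on V L = {f \<in> V. \<forall>y. L f y = 0}"

definition span1 :: "(real \<Rightarrow> real) \<Rightarrow> (real \<Rightarrow> real) set" where
  "span1 g = {(\<lambda>y. a * g y) | a. True}"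

text \<open>\<open>V / W\<close> has dimension \<open>n\<close>: the classes of some \<open>b 0, \<dots>, b (n - 1)\<close> form a basis.\<close>

definition quotient_dim :: "(real \<Rightarrow> real) set \<Rightarrow> (real \<Rightarrow> real) set \<Rightarrow> nat \<Rightarrow> bool" where
  "quotient_dim V W n \<longleftrightarrow>
     (\<exists>b. (\<forall>i<n. b i \<in> V) \<and>
        (\<forall>f\<in>V. \<exists>!a. (\<forall>i\<ge>n. a i = (0::real)) \<and> (\<lambda>y. f y - (\<Sum>i<n. a i * b i y)) \<in> W))"

text \<open>
  Closedness of the range is not listed: for a bounded operator between Banach spaces it follows
  from finite codimension.
\<close>

definition fredholm_with_index :: "(real \<Rightarrow> real) set \<Rightarrow> (real \<Rightarrow> real) set
    \<Rightarrow> ((real \<Rightarrow> real) \<Rightarrow> real \<Rightarrow> real) \<Rightarrow> int \<Rightarrow> bool" where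
  "fredholm_with_index V W L i \<longleftrightarrow>
     L ` V \<subseteq> W \<and>
     (\<exists>m n. quotient_dim (kernel_on V L) {\<lambda>_. 0} m \<and> quotient_dim W (L ` V) n \<and> i = int m - int n)"

text \<open>\<open>h\<close> is the image of \<open>g\<close> under the adjoint of \<open>L : V \<rightarrow> W\<close> for the pairing \<open>\<langle>f g\<rangle>\<close>.\<close>

definition adjoint_maps_to :: "(real \<Rightarrow> real) set \<Rightarrow> ((real \<Rightarrow> real) \<Rightarrow> real \<Rightarrow> real)
    \<Rightarrow> (real \<Rightarrow> real) \<Rightarrow> (real \<Rightarrow> real) \<Rightarrow> bool" where
  "adjoint_maps_to V L g h \<longleftrightarrow> (\<forall>f\<in>V. avg (\<lambda>y. L f y * g y) = avg (\<lambda>y. f y * h y))"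

definition adjoint_kernel :: "(real \<Rightarrow> real) set \<Rightarrow> (real \<Rightarrow> real) set
    \<Rightarrow> ((real \<Rightarrow> real) \<Rightarrow> real \<Rightarrow> real) \<Rightarrow> (real \<Rightarrow> real) set" where
  "adjoint_kernel V W L = {g \<in> W. adjoint_maps_to V L g (\<lambda>_. 0)}"

text \<open>
  The operator is considered from the \<open>C\<^sup>4\<close> to the continuous \<open>1\<close>-periodic functions.  The
  kernel is one-dimensional because \<open>U\<close> is not constant in \<open>y\<close>.
\<close>

definition standing_assumption :: "real \<Rightarrow> (real \<times> real) set
    \<Rightarrow> (real \<times> real \<times> real \<Rightarrow> real) \<Rightarrow> (real \<times> real \<Rightarrow> real) \<Rightarrow> bool" where
  "standing_assumption \<delta> P U c \<longleftrightarrow>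
     (\<forall>(k, M)\<in>P. let L = lin_op \<delta> U c (k, M) in
        kernel_on (C_per 4) L = span1 (deriv (\<lambda>y. U (y, k, M))) \<and>
        fredholm_with_index (C_per 4) (C_per 0) L 0 \<and>
        adjoint_kernel (C_per 4) (C_per 0) L = span1 (\<lambda>_. 1))"


section \<open>The corrector\<close>

definition corrector_rhs :: "real \<Rightarrow> (real \<times> real \<Rightarrow> real) \<Rightarrow> (real \<times> real \<times> real \<Rightarrow> real)
    \<Rightarrow> real \<times> real \<times> real \<Rightarrow> real" where
  "corrector_rhs \<delta> k u = (\<lambda>(y, p).
     slow pd2 u (y, p) + slow pd1 (\<lambda>z. 3 * (u z)\<^sup>2) (y, p)
     + 3 * ((k p)\<^sup>2 * slow pd1 ((pd1 ^^ 2) u) (y, p) + k p * pd1 k p * (pd1 ^^ 2) u (y, p))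
     + \<delta> * (2 * k p * slow pd1 (pd1 u) (y, p) + pd1 k p * pd1 u (y, p)
          + 4 * (k p) ^ 3 * slow pd1 ((pd1 ^^ 3) u) (y, p)
          + 6 * (k p)\<^sup>2 * pd1 k p * (pd1 ^^ 3) u (y, p)))"

text \<open>\<open>f\<close> is the profile \<open>f\<^sub>0(\<cdot>;X,T)\<close> at the point \<open>p = (X,T)\<close>.\<close>

definition is_corrector :: "real \<Rightarrow> (real \<times> real \<times> real \<Rightarrow> real) \<Rightarrow> (real \<times> real \<Rightarrow> real)
    \<Rightarrow> (real \<times> real \<Rightarrow> real) \<Rightarrow> (real \<times> real \<Rightarrow> real) \<Rightarrow> (real \<times> real \<times> real \<Rightarrow> real)
    \<Rightarrow> real \<times> real \<Rightarrow> (real \<Rightarrow> real) \<Rightarrow> bool" where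
  "is_corrector \<delta> U c k M u p f \<longleftrightarrow>
     f \<in> C_per 4 \<and>
     avg (\<lambda>y. f y * pd1 U (y, k p, M p)) = 0 \<and>
     (\<forall>y. lin_op \<delta> U c (k p, M p) f y = corrector_rhs \<delta> k u (y, p))"

end

theory Submission
  imports Defs
begin

text \<open>
  Averaging the equation at order \<open>\<epsilon>\<^sup>1\<close> over \<open>y\<close> removes every term containing \<open>\<epsilon>\<^sup>-\<^sup>1 (\<partial>\<phi>) \<partial>\<^sub>y\<close> and
  leaves \<open>\<partial>\<^sub>T M\<^sub>1 + \<partial>\<^sub>X \<langle>6 u\<^sub>0 u\<^sub>1\<rangle> + \<delta> \<partial>\<^sub>X\<^sup>2 M\<^sub>0 = 0\<close>.  The equation at order \<open>\<epsilon>\<^sup>0\<close>, compared with the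
  profile equation differentiated in \<open>k\<close> and in \<open>M\<close>, gives
  \<open>u\<^sub>1 = k\<^sub>1 \<partial>\<^sub>k U - b - f\<^sub>0 - a U'\<close> with coefficients \<open>a\<close>, \<open>b\<close> depending on \<open>(X,T)\<close> only; its average
  determines \<open>\<partial>\<^sub>T \<phi>\<^sub>1\<close>, whose \<open>X\<close>-derivative is the first modulation equation, and inserting it into
  \<open>\<langle>6 u\<^sub>0 u\<^sub>1\<rangle>\<close> yields the second.  The same formula, read as a definition of \<open>f\<^sub>0\<close>, proves existence
  and smoothness of the corrector.
\<close>

section \<open>Calculus of smooth functions\<close>

text \<open>The normalization of the family gives \<partial>_M U = 1 and \<partial>_M \<Omega> = - 6
  k, and averaging the formula for u_1 gives b = - (M_1 + <f_0>). Hence the formula reads u_1 = k_1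
  \<partial>_k U + (M_1 + <f_0>) \<partial>_M U - f_0 - a U'. The first two terms vary the wave
  parameters, so they linearize \<Omega> and <3 U^2>. The term a U' is an infinitesimal phase shift
  and contributes nothing to <u_0 u_1>. The average of f_0 acts like a change of mean: it enters the
  phase equation as \<partial>_M \<Omega> <f_0> = - 6 k_0 <f_0>, and it is the reason why only f_0 -
  <f_0> appears in the flux.

  The obstacle is regularity. The corrector is prescribed separately at each (X,T), so nothing is
  known beforehand about its dependence on (X,T), although both equations differentiate averages of
  it in X. Uniqueness at each point identifies it with an explicit combination of smooth
  functions.\<close>

lemma higher_differentiable_on_cong:
  assumes "open S" "\<And>x. x \<in> S \<Longrightarrow> f x = g x" "higher_differentiable_on n S f"
  shows "higher_differentiable_on n S g"
  using assms(2,3)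
proof (induction n arbitrary: f g)
  case 0
  then show ?case using continuous_on_cong by fastforce
next
  case (Suc n)
  have d: "f differentiable (at x)" if "x \<in> S" for x using Suc.prems that by simp
  have "g differentiable (at x)" if "x \<in> S" for x
    using d[OF that] has_derivative_transform_within_open[OF _ assms(1) that, of f _ UNIV g]
      Suc.prems(1) unfolding differentiable_def by blast
  moreover have "higher_differentiable_on n S (\<lambda>x. frechet_derivative g (at x) v)" for v
  proof (rule Suc.IH)
    show "higher_differentiable_on n S (\<lambda>x. frechet_derivative f (at x) v)"
      using Suc.prems by simp
    show "frechet_derivative f (at x) v = frechet_derivative g (at x) v" if "x \<in> S" for x
      using frechet_derivative_transform_within_open[OF d[OF that] assms(1) that Suc.prems(1)]
      by simp
  qed
  ultimately show ?case by simp
qed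

text \<open>Derivatives at a point are unique, so any explicit derivative may replace
  \<open>frechet_derivative\<close>. The closure rules can then use the product, quotient and chain
  rules in their usual form.\<close>

lemma higher_differentiable_on_SucI:
  assumes "open S" "\<And>x. x \<in> S \<Longrightarrow> (f has_derivative f' x) (at x)"
    and "\<And>v. higher_differentiable_on n S (\<lambda>x. f' x v)"
  shows "higher_differentiable_on (Suc n) S f"
proof -
  have "f' x v = frechet_derivative f (at x) v" if "x \<in> S" for x v
    using frechet_derivative_at[OF assms(2)[OF that]] by simp
  then have "higher_differentiable_on n S (\<lambda>x. frechet_derivative f (at x) v)" for v
    by (rule higher_differentiable_on_cong[OF assms(1) _ assms(3)])
  then show ?thesis
    using assms(2) by (auto simp: differentiable_def)
qed

lemma higher_differentiable_on_has_derivative: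
  assumes "higher_differentiable_on (Suc n) S f" "x \<in> S"
  shows "(f has_derivative frechet_derivative f (at x)) (at x)"
  using assms frechet_derivative_works by auto

lemma higher_differentiable_on_SucD:
  "higher_differentiable_on (Suc n) S f \<Longrightarrow> higher_differentiable_on n S f"
proof (induction n arbitrary: f)
  case 0
  then show ?case
    by (auto intro!: differentiable_imp_continuous_on simp: differentiable_on_def
        differentiable_at_withinI)
next
  case (Suc n)
  then show ?case by (metis higher_differentiable_on.simps(2))
qed

lemma higher_differentiable_on_continuous:
  "higher_differentiable_on n S f \<Longrightarrow> continuous_on S f"
  by (induction n) (simp, blast dest: higher_differentiable_on_SucD)

lemma higher_differentiable_on_const: "higher_differentiable_on n S (\<lambda>_. c)"
  by (induction n arbitrary: c) auto

lemma higher_differentiable_on_bounded_linear: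
  assumes "bounded_linear f" "open S"
  shows "higher_differentiable_on n S f"
proof (cases n)
  case 0
  then show ?thesis using assms(1) by (simp add: linear_continuous_on)
next
  case (Suc m)
  show ?thesis unfolding Suc
    by (rule higher_differentiable_on_SucI[where f' = "\<lambda>_. f"])
       (auto intro: assms bounded_linear_imp_has_derivative higher_differentiable_on_const)
qed

lemma higher_differentiable_on_add:
  assumes "open S" "higher_differentiable_on n S f" "higher_differentiable_on n S g"
  shows "higher_differentiable_on n S (\<lambda>x. f x + g x)"
  using assms(2,3)
proof (induction n arbitrary: f g)
  case 0
  then show ?case by (auto intro: continuous_intros)
next
  case (Suc n)
  note d = higher_differentiable_on_has_derivative[OF Suc.prems(1)]
    higher_differentiable_on_has_derivative[OF Suc.prems(2)]
  show ?case
    by (rule higher_differentiable_on_SucI[OF assms(1) has_derivative_add[OF d]])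
       (use Suc in auto)
qed

lemma higher_differentiable_on_sum:
  assumes "open S" "\<And>i. i \<in> I \<Longrightarrow> higher_differentiable_on n S (f i)"
  shows "higher_differentiable_on n S (\<lambda>x. \<Sum>i\<in>I. f i x)"
  using assms(2)
  by (induction I rule: infinite_finite_induct)
     (auto intro: higher_differentiable_on_const higher_differentiable_on_add[OF assms(1)])

lemma higher_differentiable_on_mult:
  fixes f g :: "'a::real_normed_vector \<Rightarrow> real"
  assumes "open S" "higher_differentiable_on n S f" "higher_differentiable_on n S g"
  shows "higher_differentiable_on n S (\<lambda>x. f x * g x)"
  using assms(2,3)
proof (induction n arbitrary: f g)
  case 0
  then show ?case by (auto intro: continuous_intros)
next
  case (Suc n)
  note d = higher_differentiable_on_has_derivative[OF Suc.prems(1)]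
    higher_differentiable_on_has_derivative[OF Suc.prems(2)]
  show ?case
  proof (rule higher_differentiable_on_SucI[OF assms(1) has_derivative_mult[OF d]])
    show "higher_differentiable_on n S
      (\<lambda>x. f x * frechet_derivative g (at x) v + frechet_derivative f (at x) v * g x)" for v
      using Suc.prems higher_differentiable_on_SucD[OF Suc.prems(1)]
        higher_differentiable_on_SucD[OF Suc.prems(2)]
      by (intro higher_differentiable_on_add[OF assms(1)] Suc.IH) simp_all
  qed
qed

lemma higher_differentiable_on_inverse:
  fixes f :: "'a::real_normed_vector \<Rightarrow> real"
  assumes "open S" "\<And>x. x \<in> S \<Longrightarrow> f x \<noteq> 0" "higher_differentiable_on n S f"
  shows "higher_differentiable_on n S (\<lambda>x. inverse (f x))"
  using assms(3)
proof (induction n)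
  case 0
  then show ?case using assms(2) by (auto intro: continuous_intros)
next
  case (Suc n)
  \<comment> \<open>The derivative - f' / f^2 contains \<open>inverse (f x)\<close> again, which the
    induction hypothesis covers at order \<open>n\<close>.\<close>
  note IH = Suc.IH[OF higher_differentiable_on_SucD[OF Suc.prems]]
  show ?case
  proof (rule higher_differentiable_on_SucI[OF assms(1)])
    show "((\<lambda>x. inverse (f x)) has_derivative
        (\<lambda>v. - 1 * (inverse (f x) * frechet_derivative f (at x) v * inverse (f x)))) (at x)"
      if "x \<in> S" for x
      using Deriv.has_derivative_inverse[OF assms(2)[OF that]
          higher_differentiable_on_has_derivative[OF Suc.prems that]]
      by simp
    show "higher_differentiable_on n S
        (\<lambda>x. - 1 * (inverse (f x) * frechet_derivative f (at x) v * inverse (f x)))" for v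
      using Suc.prems
      by (intro higher_differentiable_on_mult[OF assms(1)] IH higher_differentiable_on_const) auto
  qed
qed

text \<open>The chain rule expanded in a basis: the derivative becomes a finite sum of products of
  real functions, so sums and products suffice to continue an induction on the order.\<close>

lemma has_derivative_componentwise_compose:
  fixes g :: "'b::euclidean_space \<Rightarrow> real"
  assumes f: "\<And>b. b \<in> Basis \<Longrightarrow> ((\<lambda>x. f x \<bullet> b) has_derivative f' b) (at x)"
    and g: "(g has_derivative g') (at (f x))"
  shows "((\<lambda>x. g (f x)) has_derivative (\<lambda>v. \<Sum>b\<in>Basis. f' b v * g' b)) (at x)"
proof -
  have "(f has_derivative (\<lambda>v. \<Sum>b\<in>Basis. f' b v *\<^sub>R b)) (at x)"
    using f by (subst has_derivative_componentwise_within) (simp add: inner_sum_left_Basis)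
  from diff_chain_at[OF this g]
  have "((\<lambda>x. g (f x)) has_derivative (\<lambda>v. g' (\<Sum>b\<in>Basis. f' b v *\<^sub>R b))) (at x)"
    by (simp add: o_def)
  moreover have "g' (\<Sum>b\<in>Basis. f' b v *\<^sub>R b) = (\<Sum>b\<in>Basis. f' b v * g' b)" for v
    using has_derivative_linear[OF g] by (simp add: linear_sum linear_scale)
  ultimately show ?thesis by simp
qed

text \<open>The induction keeps \<open>f\<close> fixed and varies \<open>g\<close>: each summand of
  the derivative is a derivative of a component of \<open>f\<close> times a partial derivative of
  \<open>g\<close> composed with the same \<open>f\<close>.\<close>

lemma higher_differentiable_on_compose:
  fixes g :: "'b::euclidean_space \<Rightarrow> real"
  assumes "open S" "f ` S \<subseteq> T"
    and "\<And>b. b \<in> Basis \<Longrightarrow> higher_differentiable_on n S (\<lambda>x. f x \<bullet> b)"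
    and "higher_differentiable_on n T g"
  shows "higher_differentiable_on n S (\<lambda>x. g (f x))"
  using assms(3,4)
proof (induction n arbitrary: g)
  case 0
  have "continuous_on S f"
    using 0 by (subst continuous_on_componentwise) simp
  then show ?case
    using 0 assms(2) by (auto intro: continuous_on_compose2)
next
  case (Suc n)
  have "((\<lambda>x. g (f x)) has_derivative (\<lambda>v. \<Sum>b\<in>Basis.
      frechet_derivative (\<lambda>x. f x \<bullet> b) (at x) v * frechet_derivative g (at (f x)) b)) (at x)"
    if "x \<in> S" for x
  proof (rule has_derivative_componentwise_compose)
    show "((\<lambda>x. f x \<bullet> b) has_derivative frechet_derivative (\<lambda>x. f x \<bullet> b) (at x)) (at x)"
      if "b \<in> Basis" for b
      by (rule higher_differentiable_on_has_derivative[OF Suc.prems(1)[OF that] \<open>x \<in> S\<close>])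
    show "(g has_derivative frechet_derivative g (at (f x))) (at (f x))"
      by (rule higher_differentiable_on_has_derivative[OF Suc.prems(2)])
         (use assms(2) that in auto)
  qed
  then show ?case
  proof (rule higher_differentiable_on_SucI[OF assms(1)])
    fix v
    have f: "higher_differentiable_on n S (\<lambda>x. frechet_derivative (\<lambda>x. f x \<bullet> b) (at x) v)"
      if "b \<in> Basis" for b
      using Suc.prems(1)[OF that] by simp
    have g: "higher_differentiable_on n T (\<lambda>x. frechet_derivative g (at x) b)" for b
      using Suc.prems(2) by simp
    show "higher_differentiable_on n S (\<lambda>x. \<Sum>b\<in>Basis.
        frechet_derivative (\<lambda>x. f x \<bullet> b) (at x) v * frechet_derivative g (at (f x)) b)"
      by (intro higher_differentiable_on_sum[OF assms(1)] higher_differentiable_on_mult[OF assms(1)]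
          Suc.IH[OF _ g] f higher_differentiable_on_SucD[OF Suc.prems(1)])
  qed
qed

section \<open>Closure rules for smooth functions\<close>

lemma smooth_on_cong:
  "open S \<Longrightarrow> smooth_on S f \<Longrightarrow> (\<And>x. x \<in> S \<Longrightarrow> f x = g x) \<Longrightarrow> smooth_on S g"
  unfolding smooth_on_def by (meson higher_differentiable_on_cong)

lemma smooth_on_const [simp]: "smooth_on S (\<lambda>_. c)"
  by (simp add: smooth_on_def higher_differentiable_on_const)

lemma smooth_on_bounded_linear: "bounded_linear f \<Longrightarrow> open S \<Longrightarrow> smooth_on S f"
  by (simp add: smooth_on_def higher_differentiable_on_bounded_linear)

lemma smooth_on_add:
  "open S \<Longrightarrow> smooth_on S f \<Longrightarrow> smooth_on S g \<Longrightarrow> smooth_on S (\<lambda>x. f x + g x)"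
  by (simp add: smooth_on_def higher_differentiable_on_add)

lemma smooth_on_sum:
  "open S \<Longrightarrow> (\<And>i. i \<in> I \<Longrightarrow> smooth_on S (f i)) \<Longrightarrow> smooth_on S (\<lambda>x. \<Sum>i\<in>I. f i x)"
  by (simp add: smooth_on_def higher_differentiable_on_sum)

lemma smooth_on_mult:
  fixes f g :: "'a::real_normed_vector \<Rightarrow> real"
  shows "open S \<Longrightarrow> smooth_on S f \<Longrightarrow> smooth_on S g \<Longrightarrow> smooth_on S (\<lambda>x. f x * g x)"
  by (simp add: smooth_on_def higher_differentiable_on_mult)

lemma smooth_on_minus:
  fixes f :: "'a::real_normed_vector \<Rightarrow> real"
  shows "open S \<Longrightarrow> smooth_on S f \<Longrightarrow> smooth_on S (\<lambda>x. - f x)"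
  using smooth_on_mult[of S "\<lambda>_. - 1" f] by simp

lemma smooth_on_diff:
  fixes f g :: "'a::real_normed_vector \<Rightarrow> real"
  shows "open S \<Longrightarrow> smooth_on S f \<Longrightarrow> smooth_on S g \<Longrightarrow> smooth_on S (\<lambda>x. f x - g x)"
  using smooth_on_add[OF _ _ smooth_on_minus, of S f g] by simp

lemma smooth_on_power:
  fixes f :: "'a::real_normed_vector \<Rightarrow> real"
  shows "open S \<Longrightarrow> smooth_on S f \<Longrightarrow> smooth_on S (\<lambda>x. f x ^ n)"
  by (induction n) (auto intro: smooth_on_mult)

lemma smooth_on_divide:
  fixes f g :: "'a::real_normed_vector \<Rightarrow> real"
  assumes "open S" "smooth_on S f" "smooth_on S g" "\<And>x. x \<in> S \<Longrightarrow> g x \<noteq> 0"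
  shows "smooth_on S (\<lambda>x. f x / g x)"
  using assms
  by (auto simp: smooth_on_def divide_inverse
      intro!: higher_differentiable_on_mult higher_differentiable_on_inverse)

lemma smooth_on_compose:
  fixes g :: "'b::euclidean_space \<Rightarrow> real"
  assumes "open S" "f ` S \<subseteq> T" "\<And>b. b \<in> Basis \<Longrightarrow> smooth_on S (\<lambda>x. f x \<bullet> b)" "smooth_on T g"
  shows "smooth_on S (\<lambda>x. g (f x))"
  using assms(3,4) unfolding smooth_on_def
  by (auto intro: higher_differentiable_on_compose[OF assms(1,2)])

lemmas smooth_on_intros =
  smooth_on_const smooth_on_add smooth_on_mult smooth_on_minus smooth_on_diff smooth_on_power

lemma smooth_on_has_derivative:
  "smooth_on S f \<Longrightarrow> x \<in> S \<Longrightarrow> (f has_derivative frechet_derivative f (at x)) (at x)"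
  unfolding smooth_on_def using higher_differentiable_on_has_derivative by blast

lemma smooth_on_continuous: "smooth_on S f \<Longrightarrow> continuous_on S f"
  unfolding smooth_on_def using higher_differentiable_on_continuous by blast

lemma smooth_on_frechet_derivative:
  "smooth_on S f \<Longrightarrow> smooth_on S (\<lambda>x. frechet_derivative f (at x) v)"
  unfolding smooth_on_def by (metis higher_differentiable_on.simps(2))

text \<open>The chain rule in the shape needed for restricting to a slice and for inserting
  modulated parameters (k,M) = (k_0, M_0)(X,T) into the wave profile.\<close>

lemma smooth_on_Pair_compose:
  fixes g :: "'b::euclidean_space \<times> 'c::euclidean_space \<Rightarrow> real"
  assumes "open S" "\<And>x. x \<in> S \<Longrightarrow> (a x, b x) \<in> T"
    and "\<And>i. i \<in> Basis \<Longrightarrow> smooth_on S (\<lambda>x. a x \<bullet> i)"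
    and "\<And>i. i \<in> Basis \<Longrightarrow> smooth_on S (\<lambda>x. b x \<bullet> i)"
    and "smooth_on T g"
  shows "smooth_on S (\<lambda>x. g (a x, b x))"
  by (rule smooth_on_compose[OF assms(1) _ _ assms(5)])
     (use assms in \<open>auto simp: Basis_prod_def inner_Pair\<close>)

lemma smooth_on_snd:
  fixes h :: "'b::euclidean_space \<Rightarrow> real" and D :: "'b set"
  assumes "open D" "smooth_on D h"
  shows "smooth_on ((UNIV :: 'a::euclidean_space set) \<times> D) (\<lambda>z. h (snd z))"
proof (rule smooth_on_compose[OF _ _ _ assms(2)])
  show "smooth_on (UNIV \<times> D) (\<lambda>z :: 'a \<times> 'b. snd z \<bullet> b)" for b
    by (rule smooth_on_bounded_linear)
       (auto intro!: bounded_linear_intros open_Times assms)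
qed (auto intro: open_Times assms)

lemma smooth_on_slice:
  fixes g :: "real \<times> 'b::euclidean_space \<Rightarrow> real"
  assumes "smooth_on (UNIV \<times> D) g" "p \<in> D"
  shows "smooth_on UNIV (\<lambda>y. g (y, p))"
  by (rule smooth_on_Pair_compose[OF _ _ _ _ assms(1)])
     (auto simp: assms(2) intro: smooth_on_bounded_linear bounded_linear_intros)

section \<open>Directional and partial derivatives\<close>

text \<open>Common interface for \<open>pd1\<close>, \<open>pd2\<close>, \<open>slow pd1\<close> and
  \<open>slow pd2\<close>. These are defined through \<open>deriv\<close>, which is informative only
  where the function is differentiable; on smooth functions each is the Frechet derivative in a
  fixed direction \<open>v\<close>, so every calculus rule is proved once.\<close>

definition directional ::
    "'a::real_normed_vector set \<Rightarrow> (('a \<Rightarrow> real) \<Rightarrow> 'a \<Rightarrow> real) \<Rightarrow> 'a \<Rightarrow> bool" where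
  "directional S d v \<longleftrightarrow>
     (\<forall>f z. smooth_on S f \<longrightarrow> z \<in> S \<longrightarrow> d f z = frechet_derivative f (at z) v)"

lemma directionalD:
  "directional S d v \<Longrightarrow> smooth_on S f \<Longrightarrow> z \<in> S \<Longrightarrow> d f z = frechet_derivative f (at z) v"
  by (simp add: directional_def)

lemma directional_eqI:
  assumes "directional S d v" "open S" "smooth_on S f" "z \<in> S"
    and "\<And>x. x \<in> S \<Longrightarrow> g x = f x" "(f has_derivative f') (at z)"
  shows "d g z = f' v"
proof -
  have "(g has_derivative f') (at z)"
    using has_derivative_transform_within_open[OF assms(6,2,4)] assms(5) by simp
  moreover have "smooth_on S g" using smooth_on_cong[OF assms(2,3)] assms(5) by simp
  ultimately show ?thesis
    using directionalD[OF assms(1) _ assms(4)] frechet_derivative_at by metis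
qed

text \<open>Permits rewriting under a derivative with an identity that is known only on
  \<open>S\<close>. Nearly all identities between coefficients and averages below hold only over
  \<open>D\<close>.\<close>

lemma directional_cong:
  assumes "directional S d v" "open S" "smooth_on S f" "\<And>x. x \<in> S \<Longrightarrow> g x = f x" "z \<in> S"
  shows "d g z = d f z"
  using directional_eqI[OF assms(1,2,3,5,4) smooth_on_has_derivative[OF assms(3,5)]]
    directionalD[OF assms(1,3,5)] by simp

lemma smooth_on_directional:
  assumes "directional S d v" "open S" "smooth_on S f"
  shows "smooth_on S (d f)"
  by (rule smooth_on_cong[OF assms(2) smooth_on_frechet_derivative[OF assms(3)]])
     (simp add: directionalD[OF assms(1,3)])

lemma directional_const:
  "directional S d v \<Longrightarrow> z \<in> S \<Longrightarrow> d (\<lambda>_. c) z = 0"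
  by (simp add: directionalD)

lemma directional_add:
  assumes "directional S d v" "open S" "smooth_on S f" "smooth_on S g" "z \<in> S"
  shows "d (\<lambda>x. f x + g x) z = d f z + d g z"
  using directional_eqI[OF assms(1,2) smooth_on_add[OF assms(2,3,4)] assms(5) _
      has_derivative_add[OF assms(3,4)[THEN smooth_on_has_derivative[OF _ assms(5)]]]]
    directionalD[OF assms(1) _ assms(5)] assms(3,4) by simp

lemma directional_mult:
  assumes "directional S d v" "open S" "smooth_on S f" "smooth_on S g" "z \<in> S"
  shows "d (\<lambda>x. f x * g x) z = d f z * g z + f z * d g z"
  using directional_eqI[OF assms(1,2) smooth_on_mult[OF assms(2,3,4)] assms(5) _
      has_derivative_mult[OF assms(3,4)[THEN smooth_on_has_derivative[OF _ assms(5)]]]]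
    directionalD[OF assms(1) _ assms(5)] assms(3,4) by simp

lemma directional_cmult:
  assumes "directional S d v" "open S" "smooth_on S f" "z \<in> S"
  shows "d (\<lambda>x. c * f x) z = c * d f z"
  using directional_mult[OF assms(1,2) smooth_on_const assms(3,4)] directional_const[OF assms(1,4)]
  by simp

lemma directional_minus:
  assumes "directional S d v" "open S" "smooth_on S f" "z \<in> S"
  shows "d (\<lambda>x. - f x) z = - d f z"
  using directional_cmult[OF assms, of "-1"] by simp

lemma directional_diff:
  assumes "directional S d v" "open S" "smooth_on S f" "smooth_on S g" "z \<in> S"
  shows "d (\<lambda>x. f x - g x) z = d f z - d g z"
  using directional_add[OF assms(1,2,3) smooth_on_minus[OF assms(2,4)] assms(5)]
    directional_minus[OF assms(1,2,4,5)] by simp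

lemma directional_power:
  assumes "directional S d v" "open S" "smooth_on S f" "z \<in> S"
  shows "d (\<lambda>x. f x ^ n) z = of_nat n * f z ^ (n - 1) * d f z"
proof (induction n)
  case 0
  then show ?case using directional_const[OF assms(1,4)] by simp
next
  case (Suc n)
  then show ?case
    using directional_mult[OF assms(1,2,3) smooth_on_power[OF assms(2,3)] assms(4), of n]
    by (cases n) (auto simp: algebra_simps)
qed

lemma DERIV_along_curve:
  fixes f :: "'a::real_normed_vector \<Rightarrow> real"
  assumes "(f has_derivative f') (at (\<gamma> t))" "(\<gamma> has_derivative (\<lambda>h. h *\<^sub>R v)) (at t)"
  shows "((\<lambda>s. f (\<gamma> s)) has_field_derivative f' v) (at t)"
proof -
  have "((\<lambda>s. f (\<gamma> s)) has_derivative (\<lambda>h. f' (h *\<^sub>R v))) (at t)"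
    using diff_chain_at[OF assms(2,1)] by (simp add: o_def)
  also have "(\<lambda>h. f' (h *\<^sub>R v)) = (*) (f' v)"
    using has_derivative_linear[OF assms(1)] by (auto simp: linear_scale)
  finally show ?thesis by (simp add: has_field_derivative_def)
qed

lemma DERIV_pd1:
  fixes f :: "real \<times> 'a::real_normed_vector \<Rightarrow> real"
  assumes "smooth_on S f" "(a, q) \<in> S"
  shows "((\<lambda>s. f (s, q)) has_field_derivative frechet_derivative f (at (a, q)) (1, 0)) (at a)"
  using smooth_on_has_derivative[OF assms]
  by (rule DERIV_along_curve) (auto intro!: derivative_eq_intros)

lemma directional_pd1:
  fixes S :: "(real \<times> 'a::real_normed_vector) set"
  shows "directional S pd1 (1, 0)"
  by (auto simp: directional_def pd1_def intro!: DERIV_imp_deriv DERIV_pd1)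

lemma directional_pd2: "directional S pd2 (0, 1)"
proof -
  have "((\<lambda>s. f (a, s)) has_field_derivative frechet_derivative f (at (a, q)) (0, 1)) (at q)"
    if "smooth_on S f" "(a, q) \<in> S" for f :: "real \<times> real \<Rightarrow> real" and a q
    using smooth_on_has_derivative[OF that]
    by (rule DERIV_along_curve) (auto intro!: derivative_eq_intros)
  then show ?thesis
    by (auto simp: directional_def pd2_def intro!: DERIV_imp_deriv)
qed

lemma directional_slow_pd1: "directional S (slow pd1) (0, 1, 0)"
proof -
  have "((\<lambda>s. f (y, s, b)) has_field_derivative frechet_derivative f (at (y, a, b)) (0, 1, 0)) (at a)"
    if "smooth_on S f" "(y, a, b) \<in> S" for f :: "real \<times> real \<times> real \<Rightarrow> real" and y a b
    using smooth_on_has_derivative[OF that]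
    by (rule DERIV_along_curve) (auto intro!: derivative_eq_intros)
  then show ?thesis
    by (auto simp: directional_def pd1_def slow_def intro!: DERIV_imp_deriv)
qed

lemma directional_slow_pd2: "directional S (slow pd2) (0, 0, 1)"
proof -
  have "((\<lambda>s. f (y, a, s)) has_field_derivative frechet_derivative f (at (y, a, b)) (0, 0, 1)) (at b)"
    if "smooth_on S f" "(y, a, b) \<in> S" for f :: "real \<times> real \<times> real \<Rightarrow> real" and y a b
    using smooth_on_has_derivative[OF that]
    by (rule DERIV_along_curve) (auto intro!: derivative_eq_intros)
  then show ?thesis
    by (auto simp: directional_def pd2_def slow_def intro!: DERIV_imp_deriv)
qed

text \<open>
  Differentiate \<open>f (x + s v + t w) - f (x + t w) = \<integral>\<^sub>0\<^sup>s (\<partial>\<^sub>v f) (x + \<sigma> v + t w) d\<sigma>\<close> first in \<open>t\<close>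
  under the integral sign and then in \<open>s\<close>.
\<close>

lemma frechet_derivative_commute:
  fixes f :: "'a::real_normed_vector \<Rightarrow> real"
  assumes "open S" "smooth_on S f" "x \<in> S"
  shows "frechet_derivative (\<lambda>z. frechet_derivative f (at z) v) (at x) w
       = frechet_derivative (\<lambda>z. frechet_derivative f (at z) w) (at x) v"
proof -
  define Dv where "Dv = (\<lambda>z. frechet_derivative f (at z) v)"
  define Dw where "Dw = (\<lambda>z. frechet_derivative f (at z) w)"
  define DwDv where "DwDv = (\<lambda>z. frechet_derivative Dv (at z) w)"
  note sm = smooth_on_frechet_derivative[OF assms(2)]
  have Dv: "smooth_on S Dv" and Dw: "smooth_on S Dw" unfolding Dv_def Dw_def by (rule sm)+
  have DwDv: "smooth_on S DwDv" unfolding DwDv_def by (rule smooth_on_frechet_derivative[OF Dv])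
  define \<gamma> where "\<gamma> = (\<lambda>(s::real, t::real). x + s *\<^sub>R v + t *\<^sub>R w)"
  have c\<gamma>: "continuous_on UNIV \<gamma>"
    unfolding \<gamma>_def by (auto simp: case_prod_unfold intro!: continuous_intros)
  have op: "open (\<gamma> -` S)" using open_vimage[OF assms(1) c\<gamma>] .
  have "(0, 0) \<in> \<gamma> -` S" using assms(3) by (simp add: \<gamma>_def)
  from open_prod_elim[OF op this] obtain A B where AB: "open A" "open B" "(0, 0) \<in> A \<times> B"
    "A \<times> B \<subseteq> \<gamma> -` S" by metis
  then have "open (A \<inter> B)" "0 \<in> A \<inter> B" by auto
  then obtain e where e: "e > 0" "cball 0 e \<subseteq> A \<inter> B"
    by (meson open_contains_cball)
  have mem: "x + s *\<^sub>R v + t *\<^sub>R w \<in> S" if "\<bar>s\<bar> \<le> e" "\<bar>t\<bar> \<le> e" for s t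
  proof -
    have "s \<in> cball 0 e" "t \<in> cball 0 e" using that by auto
    then have "(s, t) \<in> A \<times> B" using e by blast
    then show ?thesis using AB(4) by (auto simp: \<gamma>_def)
  qed
  have inS: "DERIV (\<lambda>s. g (x + s *\<^sub>R v + t *\<^sub>R w)) s :> frechet_derivative g (at (x + s *\<^sub>R v + t *\<^sub>R w)) v"
    and inT: "DERIV (\<lambda>t. g (x + s *\<^sub>R v + t *\<^sub>R w)) t :> frechet_derivative g (at (x + s *\<^sub>R v + t *\<^sub>R w)) w"
    if "smooth_on S g" "\<bar>s\<bar> \<le> e" "\<bar>t\<bar> \<le> e" for g s t
    using smooth_on_has_derivative[OF that(1) mem[OF that(2,3)]]
    by (rule DERIV_along_curve, auto intro!: derivative_eq_intros)+
  have ftc: "f (x + s *\<^sub>R v + t *\<^sub>R w) - f (x + t *\<^sub>R w)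
      = integral {0..s} (\<lambda>\<sigma>. Dv (x + \<sigma> *\<^sub>R v + t *\<^sub>R w))"
    if "0 \<le> s" "s \<le> e" "\<bar>t\<bar> \<le> e" for s t
  proof -
    have "((\<lambda>\<sigma>. Dv (x + \<sigma> *\<^sub>R v + t *\<^sub>R w)) has_integral
        f (x + s *\<^sub>R v + t *\<^sub>R w) - f (x + 0 *\<^sub>R v + t *\<^sub>R w)) {0..s}"
    proof (rule fundamental_theorem_of_calculus[OF that(1)])
      fix \<sigma> assume "\<sigma> \<in> {0..s}"
      then have "\<bar>\<sigma>\<bar> \<le> e" using that by auto
      from inS[OF assms(2) this that(3)]
      show "((\<lambda>\<sigma>. f (x + \<sigma> *\<^sub>R v + t *\<^sub>R w)) has_vector_derivative Dv (x + \<sigma> *\<^sub>R v + t *\<^sub>R w))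
          (at \<sigma> within {0..s})"
        unfolding Dv_def has_real_derivative_iff_has_vector_derivative
        by (rule has_vector_derivative_at_within)
    qed
    then show ?thesis by (simp add: integral_unique)
  qed
  have cont: "continuous_on {z. \<bar>fst z\<bar> \<le> e \<and> \<bar>snd z\<bar> \<le> e} (\<lambda>z. g (x + snd z *\<^sub>R v + fst z *\<^sub>R w))"
    if "smooth_on S g" for g :: "'a \<Rightarrow> real"
    by (rule continuous_on_compose2[OF smooth_on_continuous[OF that]])
       (auto intro!: continuous_intros mem)
  have Dw_eq: "Dw (x + s *\<^sub>R v) = Dw x + integral {0..s} (\<lambda>\<sigma>. DwDv (x + \<sigma> *\<^sub>R v))"
    if s: "s \<in> {0..e}" for s
  proof -
    have "((\<lambda>t. integral (cbox 0 s) (\<lambda>\<sigma>. Dv (x + \<sigma> *\<^sub>R v + t *\<^sub>R w))) has_field_derivative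
        integral (cbox 0 s) (\<lambda>\<sigma>. DwDv (x + \<sigma> *\<^sub>R v + 0 *\<^sub>R w))) (at 0 within {-e..e})"
    proof (rule leibniz_rule_field_derivative)
      fix t \<sigma> :: real assume "t \<in> {-e..e}" "\<sigma> \<in> cbox 0 s"
      then show "((\<lambda>t. Dv (x + \<sigma> *\<^sub>R v + t *\<^sub>R w)) has_field_derivative
          DwDv (x + \<sigma> *\<^sub>R v + t *\<^sub>R w)) (at t within {-e..e})"
        unfolding DwDv_def using s
        by (intro has_field_derivative_at_within[OF inT[OF Dv]]) auto
    next
      fix t assume t: "t \<in> {-e..e}"
      have "continuous_on (cbox 0 s) (\<lambda>\<sigma>. Dv (x + \<sigma> *\<^sub>R v + t *\<^sub>R w))"
        by (rule continuous_on_compose2[OF smooth_on_continuous[OF Dv]])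
           (use s t in \<open>auto intro!: continuous_intros mem\<close>)
      then show "(\<lambda>\<sigma>. Dv (x + \<sigma> *\<^sub>R v + t *\<^sub>R w)) integrable_on cbox 0 s"
        by (rule integrable_continuous)
    next
      show "continuous_on ({-e..e} \<times> cbox 0 s) (\<lambda>(t, \<sigma>). DwDv (x + \<sigma> *\<^sub>R v + t *\<^sub>R w))"
        unfolding case_prod_unfold
        by (rule continuous_on_subset[OF cont[OF DwDv]]) (use s in auto)
    qed (use e in auto)
    then have "((\<lambda>t. integral {0..s} (\<lambda>\<sigma>. Dv (x + \<sigma> *\<^sub>R v + t *\<^sub>R w))) has_field_derivative
        integral {0..s} (\<lambda>\<sigma>. DwDv (x + \<sigma> *\<^sub>R v))) (at 0 within {-e..e})"
      by simp
    from has_field_derivative_transform_within[OF this e(1)]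
    have 1: "((\<lambda>t. f (x + s *\<^sub>R v + t *\<^sub>R w) - f (x + 0 *\<^sub>R v + t *\<^sub>R w)) has_field_derivative
        integral {0..s} (\<lambda>\<sigma>. DwDv (x + \<sigma> *\<^sub>R v))) (at 0 within {-e..e})"
      using ftc s e by auto
    have "((\<lambda>t. f (x + s *\<^sub>R v + t *\<^sub>R w) - f (x + 0 *\<^sub>R v + t *\<^sub>R w)) has_field_derivative
        Dw (x + s *\<^sub>R v + 0 *\<^sub>R w) - Dw (x + 0 *\<^sub>R v + 0 *\<^sub>R w)) (at 0 within {-e..e})"
      unfolding Dw_def using s e
      by (intro has_field_derivative_at_within[OF DERIV_diff] inT[OF assms(2)]) simp_all
    with 1 have "Dw (x + s *\<^sub>R v + 0 *\<^sub>R w) - Dw (x + 0 *\<^sub>R v + 0 *\<^sub>R w)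
        = integral {0..s} (\<lambda>\<sigma>. DwDv (x + \<sigma> *\<^sub>R v))"
      using vector_derivative_unique_within_closed_interval[of "-e" e 0] e
      unfolding has_real_derivative_iff_has_vector_derivative cbox_interval by auto
    then show ?thesis by simp
  qed
  have "continuous_on {0..e} (\<lambda>\<sigma>. DwDv (x + \<sigma> *\<^sub>R v))"
    by (rule continuous_on_compose2[OF smooth_on_continuous[OF DwDv]])
       (use mem[of _ 0] e in \<open>auto intro!: continuous_intros\<close>)
  from integral_has_real_derivative[OF this, of 0] e
  have "((\<lambda>s. Dw x + integral {0..s} (\<lambda>\<sigma>. DwDv (x + \<sigma> *\<^sub>R v))) has_field_derivative DwDv x)
      (at 0 within {0..e})"
    by (auto intro!: derivative_eq_intros)
  then have 1: "((\<lambda>s. Dw (x + s *\<^sub>R v)) has_field_derivative DwDv x) (at 0 within {0..e})"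
    by (rule has_field_derivative_transform_within[where d = 1]) (use Dw_eq e in auto)
  have "((\<lambda>s. Dw (x + s *\<^sub>R v)) has_field_derivative frechet_derivative Dw (at x) v)
      (at 0 within {0..e})"
    using inS[OF Dw, of 0 0] e by (auto intro: has_field_derivative_at_within)
  \<comment> \<open>The parameter \<open>s\<close> runs through [0, e] only, so the derivative at 0
    is one-sided; derivatives within a nondegenerate interval are still unique.\<close>
  with 1 have "DwDv x = frechet_derivative Dw (at x) v"
    using vector_derivative_unique_within_closed_interval[of 0 e 0] e
    unfolding has_real_derivative_iff_has_vector_derivative cbox_interval by auto
  then show ?thesis by (simp add: DwDv_def Dv_def Dw_def)
qed

lemma directional_commute:
  assumes "directional S d v" "directional S e w" "open S" "smooth_on S f" "z \<in> S"
  shows "d (e f) z = e (d f) z"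
proof -
  have *: "d (e f) z = frechet_derivative (\<lambda>z. frechet_derivative f (at z) w) (at z) v"
    if "directional S d v" "directional S e w" for d e v w
    using directional_cong[OF that(1) assms(3) smooth_on_frechet_derivative[OF assms(4)] _ assms(5)]
      directionalD[OF that(1) smooth_on_frechet_derivative[OF assms(4)] assms(5)]
      directionalD[OF that(2) assms(4)] by metis
  show ?thesis
    using *[OF assms(1,2)] *[OF assms(2,1)] frechet_derivative_commute[OF assms(3-5)] by metis
qed

section \<open>Averages over a period\<close>

lemma avg_const [simp]: "avg (\<lambda>_. c) = c"
  by (simp add: avg_def)

lemma integrable_on_unit:
  "continuous_on UNIV f \<Longrightarrow> f integrable_on {0..1::real}" for f :: "real \<Rightarrow> real"
  by (meson continuous_on_subset integrable_continuous_real subset_UNIV)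

lemma avg_add:
  "continuous_on UNIV f \<Longrightarrow> continuous_on UNIV g \<Longrightarrow> avg (\<lambda>y. f y + g y) = avg f + avg g"
  by (simp add: avg_def integral_add integrable_on_unit)

lemma avg_cmult: "avg (\<lambda>y. c * f y) = c * avg f"
  by (simp add: avg_def)

lemma avg_diff:
  "continuous_on UNIV f \<Longrightarrow> continuous_on UNIV g \<Longrightarrow> avg (\<lambda>y. f y - g y) = avg f - avg g"
  by (simp add: avg_def integral_diff integrable_on_unit)

lemma avg_sum:
  "finite I \<Longrightarrow> (\<And>i. i \<in> I \<Longrightarrow> continuous_on UNIV (f i)) \<Longrightarrow>
    avg (\<lambda>y. \<Sum>i\<in>I. f i y) = (\<Sum>i\<in>I. avg (f i))"
  by (simp add: avg_def integral_sum integrable_on_unit)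

text \<open>Differentiation under the integral sign, in all parameter directions at once. Finite
  order instead of smoothness is assumed so that the induction on the order in
  \<open>higher_differentiable_on_avg\<close> can use it.\<close>

lemma has_derivative_avg:
  fixes F :: "real \<times> 'a::euclidean_space \<Rightarrow> real"
  assumes "open D" "higher_differentiable_on (Suc n) (UNIV \<times> D) F" "p \<in> D"
  shows "((\<lambda>q. avg (\<lambda>y. F (y, q))) has_derivative
    (\<lambda>v. avg (\<lambda>y. frechet_derivative F (at (y, p)) (0, v)))) (at p)"
proof -
  obtain r where r: "r > 0" "ball p r \<subseteq> D" using assms(1,3) open_contains_ball by blast
  \<comment> \<open>The Leibniz rule for Frechet derivatives integrates a function with values in
    the space of bounded linear maps, hence the use of \<open>Blinfun\<close>.\<close>
  define F' where "F' = (\<lambda>q y. Blinfun (\<lambda>v. frechet_derivative F (at (y, q)) (0, v)))"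
  have dF: "(F has_derivative frechet_derivative F (at (y, q))) (at (y, q))" if "q \<in> D" for y q
    using higher_differentiable_on_has_derivative[OF assms(2)] that by simp
  have dF2: "((\<lambda>q. F (y, q)) has_derivative (\<lambda>v. frechet_derivative F (at (y, q)) (0, v))) (at q)"
    if "q \<in> D" for y q
  proof -
    have "((\<lambda>q. (y, q)) has_derivative (\<lambda>v. (0, v))) (at q)" by (auto intro!: derivative_eq_intros)
    from diff_chain_at[OF this dF[OF that]] show ?thesis by (simp add: o_def)
  qed
  have F'_apply: "blinfun_apply (F' q y) = (\<lambda>v. frechet_derivative F (at (y, q)) (0, v))"
    if "q \<in> D" for y q
    unfolding F'_def
    by (rule bounded_linear_Blinfun_apply) (rule has_derivative_bounded_linear[OF dF2[OF that]])
  have swap: "continuous_on (ball p r \<times> cbox 0 1) (\<lambda>(q, y). g (y, q))"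
    if "continuous_on (UNIV \<times> D) g" for g :: "real \<times> 'a \<Rightarrow> real"
    unfolding case_prod_unfold
    by (rule continuous_on_compose2[OF that]) (use r in \<open>auto intro!: continuous_intros\<close>)
  have cF': "continuous_on (ball p r \<times> cbox 0 1) (\<lambda>(q, y). F' q y)"
  proof (rule continuous_on_blinfun_componentwise)
    fix i :: 'a
    have "continuous_on (UNIV \<times> D) (\<lambda>z. frechet_derivative F (at z) (0, i))"
      using assms(2) by (intro higher_differentiable_on_continuous[of n]) simp
    from swap[OF this] show "continuous_on (ball p r \<times> cbox 0 1) (\<lambda>x. blinfun_apply (case x of (q, y) \<Rightarrow> F' q y) i)"
      by (rule continuous_on_eq) (use r in \<open>auto simp: F'_apply\<close>)
  qed
  have "((\<lambda>q. integral (cbox 0 1) (\<lambda>y. F (y, q))) has_derivative integral (cbox 0 1) (F' p))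
      (at p within ball p r)"
  proof (rule leibniz_rule[OF _ _ cF'])
    fix q y assume q: "q \<in> ball p r"
    show "((\<lambda>q. F (y, q)) has_derivative blinfun_apply (F' q y)) (at q within ball p r)"
      using has_derivative_at_withinI[OF dF2[of q y]] F'_apply[of q y] q r(2) by auto
    have "continuous_on (cbox 0 1) (\<lambda>y. F (y, q))"
      by (rule continuous_on_compose2[OF higher_differentiable_on_continuous[OF assms(2)]])
         (use q r in \<open>auto intro!: continuous_intros\<close>)
    then show "(\<lambda>y. F (y, q)) integrable_on cbox 0 1" by (rule integrable_continuous)
  qed (use r in auto)
  then have "((\<lambda>q. avg (\<lambda>y. F (y, q))) has_derivative integral (cbox 0 1) (F' p)) (at p)"
    using r by (simp add: avg_def at_within_open[of p "ball p r"])
  moreover have "blinfun_apply (integral (cbox 0 1) (F' p)) =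
      (\<lambda>v. avg (\<lambda>y. frechet_derivative F (at (y, p)) (0, v)))"
  proof
    have "continuous_on (cbox 0 1) (F' p)"
      using continuous_on_compose2[OF cF'
          continuous_on_Pair[OF continuous_on_const[of "cbox 0 1" p] continuous_on_id]] r
      by (simp add: image_subset_iff)
    then have "F' p integrable_on cbox 0 1" by (rule integrable_continuous)
    then show "blinfun_apply (integral (cbox 0 1) (F' p)) v =
      avg (\<lambda>y. frechet_derivative F (at (y, p)) (0, v))" for v
      by (simp add: blinfun_apply_integral F'_apply[OF assms(3)] avg_def)
  qed
  ultimately show ?thesis by simp
qed

text \<open>Each directional derivative of the average is the average of a directional derivative of
  \<open>F\<close>, so the induction hypothesis applies to that derivative.\<close>

lemma higher_differentiable_on_avg:
  fixes F :: "real \<times> 'a::euclidean_space \<Rightarrow> real"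
  assumes "open D" "higher_differentiable_on n (UNIV \<times> D) F"
  shows "higher_differentiable_on n D (\<lambda>q. avg (\<lambda>y. F (y, q)))"
  using assms(2)
proof (induction n arbitrary: F)
  case 0
  have "continuous_on (D \<times> cbox 0 1) (\<lambda>(q, y). F (y, q))"
    unfolding case_prod_unfold
    by (rule continuous_on_compose2[where g = F and t = "UNIV \<times> D"])
       (use 0 in \<open>auto intro!: continuous_intros\<close>)
  from integral_continuous_on_param[OF this] show ?case by (simp add: avg_def)
next
  case (Suc n)
  show ?case
    by (rule higher_differentiable_on_SucI[OF assms(1) has_derivative_avg[OF assms(1) Suc.prems]])
       (assumption, rule Suc.IH, use Suc.prems in simp)
qed

lemma smooth_on_avg:
  fixes F :: "real \<times> 'a::euclidean_space \<Rightarrow> real"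
  shows "open D \<Longrightarrow> smooth_on (UNIV \<times> D) F \<Longrightarrow> smooth_on D (\<lambda>q. avg (\<lambda>y. F (y, q)))"
  by (simp add: smooth_on_def higher_differentiable_on_avg)

text \<open>The direction \<open>(0, v)\<close> on the cylinder does not move \<open>y\<close>, so
  the derivative commutes with the average. This serves both for (X,T) and for the wave parameters
  (k,M).\<close>

lemma directional_avg:
  fixes F :: "real \<times> 'a::euclidean_space \<Rightarrow> real"
  assumes "directional D d v" "directional (UNIV \<times> D) d' (0, v)"
    and "open D" "smooth_on (UNIV \<times> D) F" "p \<in> D"
  shows "d (\<lambda>q. avg (\<lambda>y. F (y, q))) p = avg (\<lambda>y. d' F (y, p))"
proof -
  have "higher_differentiable_on (Suc 0) (UNIV \<times> D) F"
    using assms(4) unfolding smooth_on_def by blast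
  from has_derivative_avg[OF assms(3) this assms(5)]
  have "d (\<lambda>q. avg (\<lambda>y. F (y, q))) p = avg (\<lambda>y. frechet_derivative F (at (y, p)) (0, v))"
    using directional_eqI[OF assms(1,3) smooth_on_avg[OF assms(3,4)] assms(5)] by simp
  then show ?thesis using directionalD[OF assms(2,4)] assms(5) by simp
qed

lemma continuous_on_slice:
  fixes F :: "real \<times> 'a::real_normed_vector \<Rightarrow> real"
  assumes "smooth_on (UNIV \<times> D) F" "p \<in> D"
  shows "continuous_on UNIV (\<lambda>y. F (y, p))"
  by (rule continuous_on_compose2[OF smooth_on_continuous[OF assms(1)]])
     (use assms(2) in \<open>auto intro!: continuous_intros\<close>)

lemma DERIV_slice:
  fixes F :: "real \<times> 'a::real_normed_vector \<Rightarrow> real"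
  assumes "smooth_on (UNIV \<times> D) F" "p \<in> D"
  shows "((\<lambda>y. F (y, p)) has_real_derivative pd1 F (y, p)) (at y)"
  using DERIV_pd1[OF assms(1), of y p] directionalD[OF directional_pd1 assms(1), of "(y, p)"] assms(2)
  by simp

lemma avg_pd1_periodic:
  fixes F :: "real \<times> 'a::real_normed_vector \<Rightarrow> real"
  assumes "smooth_on (UNIV \<times> D) F" "p \<in> D" "periodic1 (\<lambda>y. F (y, p))"
  shows "avg (\<lambda>y. pd1 F (y, p)) = 0"
proof -
  have "((\<lambda>y. pd1 F (y, p)) has_integral F (1, p) - F (0, p)) {0..1}"
    using DERIV_slice[OF assms(1,2)]
    by (intro fundamental_theorem_of_calculus)
       (auto simp: has_real_derivative_iff_has_vector_derivative intro: has_vector_derivative_at_within)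
  moreover have "F (1, p) = F (0, p)" using assms(3)[unfolded periodic1_def, rule_format, of 0] by simp
  ultimately show ?thesis by (simp add: avg_def integral_unique)
qed

text \<open>If the average vanished, the continuous nonnegative integrand would be zero on [0,1], so
  \<open>V\<close> would be constant there and, by periodicity, on the whole line. It makes the
  normalization against U' possible: \<open>N\<close> below is such an average.\<close>

lemma avg_deriv_square_pos:
  fixes V V' :: "real \<Rightarrow> real"
  assumes "\<And>y. (V has_real_derivative V' y) (at y)" "continuous_on UNIV V'"
    and "periodic1 V" "\<not> V constant_on UNIV"
  shows "avg (\<lambda>y. V' y * V' y) > 0"
proof -
  have c: "continuous_on {0..1} (\<lambda>y. V' y * V' y)"
    using assms(2) by (intro continuous_intros) (auto intro: continuous_on_subset)
  have "avg (\<lambda>y. V' y * V' y) \<ge> 0"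
    unfolding avg_def by (intro integral_nonneg integrable_continuous_real c) auto
  moreover have False if "avg (\<lambda>y. V' y * V' y) = 0"
  proof -
    have 0: "V' y = 0" if "y \<in> {0..1}" for y
      using integral_eq_0_iff[OF c] \<open>avg _ = 0\<close> that by (auto simp: avg_def)
    have "V y = V 0" for y
    proof -
      have per: "V (x + of_int n) = V x" for x n
      proof (induction n)
        case (nonneg n)
        then show ?case
          by (induction n) (use assms(3) in \<open>auto simp: periodic1_def add.assoc[symmetric] add.commute[of 1]\<close>)
      next
        case (neg n)
        then show ?case
        proof (induction n)
          case 0
          then show ?case using assms(3)[unfolded periodic1_def, rule_format, of "x - 1"] by simp
        next
          case (Suc n)
          then show ?case
            using assms(3)[unfolded periodic1_def, rule_format, of "x + of_int (- int (Suc (Suc n)))"]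
            by (simp add: algebra_simps)
        qed
      qed
      have "V (frac y) = V 0"
      proof (cases "frac y = 0")
        case True
        then show ?thesis by (simp only:)
      next
        case False
        then have "0 < frac y" using frac_ge_0[of y] by simp
        moreover have "frac y < 1" by (rule frac_lt_1)
        ultimately show ?thesis
          using DERIV_isconst2[of 0 1 V "frac y"] DERIV_isCont assms(1) 0
            DERIV_continuous_on[of "{0..1}" V V']
          by (metis atLeastAtMost_iff has_field_derivative_at_within less_eq_real_def zero_less_one)
      qed
      then show ?thesis using per[of "frac y" "\<lfloor>y\<rfloor>"] by (simp add: frac_def)
    qed
    then show False using assms(4) unfolding constant_on_def by blast
  qed
  ultimately show ?thesis by fastforce
qed

text \<open>Periodicity is required at all points of \<open>D\<close>, because the derivative at
  \<open>p\<close> compares \<open>F (y, q)\<close> and \<open>F (y + 1, q)\<close> for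
  \<open>q\<close> near \<open>p\<close>.\<close>

lemma periodic1_slow:
  fixes F :: "real \<times> real \<times> real \<Rightarrow> real"
  assumes "directional D d v" "open D" "smooth_on (UNIV \<times> D) F"
    and "\<And>p. p \<in> D \<Longrightarrow> periodic1 (\<lambda>y. F (y, p))" "p \<in> D"
  shows "periodic1 (\<lambda>y. slow d F (y, p))"
  unfolding periodic1_def slow_def
proof (clarsimp)
  fix y
  have "smooth_on D (\<lambda>q. F (y, q))"
    by (rule smooth_on_Pair_compose[OF assms(2) _ _ _ assms(3)])
       (use assms(2) in \<open>auto intro: smooth_on_bounded_linear bounded_linear_intros\<close>)
  then show "d (\<lambda>q. F (y + 1, q)) p = d (\<lambda>q. F (y, q)) p"
    by (rule directional_cong[OF assms(1,2) _ _ assms(5)]) (use assms(4) in \<open>auto simp only: periodic1_def\<close>)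
qed

lemma periodic1_pd1:
  assumes "periodic1 (\<lambda>y. F (y, p))"
  shows "periodic1 (\<lambda>y. pd1 F (y, p))"
proof -
  have "deriv (\<lambda>s. F (s, p)) (y + 1) = deriv (\<lambda>s. F (s, p)) y" for y
    using assms unfolding periodic1_def deriv_def by (simp add: DERIV_shift)
  then show ?thesis by (simp add: periodic1_def pd1_def)
qed

lemma periodic1_const [simp]: "periodic1 (\<lambda>_. c)"
  by (simp add: periodic1_def)

lemma periodic1_add: "periodic1 f \<Longrightarrow> periodic1 g \<Longrightarrow> periodic1 (\<lambda>y. f y + g y)"
  by (simp add: periodic1_def)

lemma periodic1_mult: "periodic1 f \<Longrightarrow> periodic1 g \<Longrightarrow> periodic1 (\<lambda>y. f y * g y)"
  by (simp add: periodic1_def)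

lemma periodic1_sum: "(\<And>i. i \<in> I \<Longrightarrow> periodic1 (f i)) \<Longrightarrow> periodic1 (\<lambda>y. \<Sum>i\<in>I. f i y)"
  by (simp add: periodic1_def)

lemmas periodic1_intros =
  periodic1_const periodic1_add periodic1_mult periodic1_sum

section \<open>Coefficients of the formal expansion\<close>

lemma sum_apply_fun: "(\<Sum>i\<in>I. f i) x = (\<Sum>i\<in>I. f i x)"
  by (induction I rule: infinite_finite_induct) auto

lemma pd1_0 [simp]: "pd1 0 = 0"
  by (auto simp: pd1_def zero_fun_def)

lemma pd2_0 [simp]: "pd2 0 = 0"
  by (auto simp: pd2_def zero_fun_def)

lemma slow_0: "d 0 = 0 \<Longrightarrow> slow d 0 = 0"
  by (auto simp: slow_def zero_fun_def)

text \<open>\<open>Abs_fls\<close> returns the intended coefficients only if they vanish far below;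
  \<open>d 0 = 0\<close> carries this property over from \<open>F\<close>.\<close>

lemma coeffwise_nth: "d 0 = 0 \<Longrightarrow> fls_nth (coeffwise d F) n = d (fls_nth F n)"
proof -
  assume "d 0 = 0"
  obtain N where "\<forall>n<N. fls_nth F n = 0" by (rule fls_nth_vanishes_belowE)
  then have "\<forall>n<N. d (fls_nth F n) = 0" using \<open>d 0 = 0\<close> by simp
  then show ?thesis unfolding coeffwise_def by (rule nth_Abs_fls_lower_bound)
qed

lemma power_series_nth: "fls_nth (power_series a) n = (if n < 0 then 0 else a (nat n))"
  by (simp add: power_series_def)

text \<open>The product formula for Laurent series has the subdegrees as summation limits. Any lower
  bounds of the supports give the same sum, since only zero terms are added or dropped; explicit
  bounds make the coefficients computable.\<close>

lemma fls_times_nth_lower_bounds: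
  fixes f g :: "'a::{comm_monoid_add, mult_zero} fls"
  assumes "\<And>n. n < a \<Longrightarrow> fls_nth f n = 0" "\<And>n. n < b \<Longrightarrow> fls_nth g n = 0"
  shows "fls_nth (f * g) n = (\<Sum>i=a..n-b. fls_nth f i * fls_nth g (n - i))"
proof -
  have "fls_nth (f * g) n = (\<Sum>i=fls_subdegree f..n - fls_subdegree g. fls_nth f i * fls_nth g (n - i))"
    by (rule fls_times_nth(2))
  also have "\<dots> = (\<Sum>i\<in>{fls_subdegree f..n - fls_subdegree g} \<inter> {a..n-b}. fls_nth f i * fls_nth g (n - i))"
    by (rule sum.mono_neutral_right) (auto simp: assms not_le)
  also have "\<dots> = (\<Sum>i=a..n-b. fls_nth f i * fls_nth g (n - i))"
    by (rule sum.mono_neutral_left) (auto simp: not_le)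
  finally show ?thesis .
qed

text \<open>The factor \<epsilon>^(-1) shifts the product by one, which explains the index
  \<open>n + 1\<close>. The bound \<open>m\<close> on the support of \<open>F\<close> makes the sum
  finite, and the sum is empty below order \<open>m - 1\<close>.\<close>

lemma subst_deriv_nth:
  assumes "\<And>n. n < m \<Longrightarrow> fls_nth F n = 0" "d 0 = 0"
  shows "fls_nth (subst_deriv d \<phi> F) n = (\<lambda>(y, p). slow d (fls_nth F n) (y, p)
      + (\<Sum>i=0..n+1-m. d (\<phi> (nat i)) p * pd1 (fls_nth F (n + 1 - i)) (y, p)))"
proof -
  have "fls_nth (power_series (\<lambda>j (y, p). d (\<phi> j) p) * coeffwise pd1 F) (n + 1) =
      (\<Sum>i=0..n+1-m. fls_nth (power_series (\<lambda>j (y, p). d (\<phi> j) p)) i * pd1 (fls_nth F (n + 1 - i)))"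
    by (subst fls_times_nth_lower_bounds[where a = 0 and b = m])
       (auto simp: power_series_nth coeffwise_nth assms(1))
  moreover have "fls_nth (subst_deriv d \<phi> F) n = slow d (fls_nth F n)
      + fls_nth (power_series (\<lambda>j (y, p). d (\<phi> j) p) * coeffwise pd1 F) (n + 1)"
    unfolding subst_deriv_def mult.assoc
    by (simp only: fls_X_inv_times_conv_shift(1) fls_plus_nth fls_shift_nth coeffwise_nth[where d = "slow d", OF slow_0[where d = d, OF assms(2)]])
  ultimately show ?thesis
    by (auto simp: sum_apply_fun power_series_nth fun_eq_iff intro!: sum.cong)
qed

lemma residual_nth:
  "fls_nth (residual \<delta> u \<phi>) n z =
    (let w = power_series u; DX = subst_deriv pd1 \<phi> in
      fls_nth (subst_deriv pd2 \<phi> w) n z + 6 * fls_nth (w * DX w) n z + fls_nth ((DX ^^ 3) w) (n - 2) z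
      + \<delta> * (fls_nth ((DX ^^ 2) w) (n - 1) z + fls_nth ((DX ^^ 4) w) (n - 3) z))"
proof -
  have "fls_nth (fls_X * f) n = fls_nth f (n - 1)" for f :: series
    using fls_X_power_times_conv_shift(1)[of 1 f] by simp
  then show ?thesis
    by (simp add: residual_def Let_def mult.assoc fls_X_power_times_conv_shift(1))
qed

text \<open>The invariant kept under iterated substituted derivatives. The bound \<open>m\<close> is
  part of it because each application lowers the first possible order by one.\<close>

definition smooth_periodic_series :: "(real \<times> real) set \<Rightarrow> int \<Rightarrow> series \<Rightarrow> bool" where
  "smooth_periodic_series D m F \<longleftrightarrow> (\<forall>n<m. fls_nth F n = 0) \<and>
     (\<forall>n. smooth_on (UNIV \<times> D) (fls_nth F n) \<and> (\<forall>p\<in>D. periodic1 (\<lambda>y. fls_nth F n (y, p))))"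

section \<open>Smoothness, periodicity and averages under a substituted derivative\<close>

context
  fixes D :: "(real \<times> real) set" and d v and \<phi> :: "nat \<Rightarrow> real \<times> real \<Rightarrow> real"
  assumes D: "open D" and d: "directional D d v" "directional (UNIV \<times> D) (slow d) (0, v)" "d 0 = 0"
    and \<phi>: "\<And>j. smooth_on D (\<phi> j)"
begin

lemma smooth_on_subst_deriv_term:
  assumes "smooth_on (UNIV \<times> D) f"
  shows "smooth_on (UNIV \<times> D) (\<lambda>z. d (\<phi> j) (snd z) * pd1 f z)"
proof -
  have o: "open (UNIV \<times> D)" by (simp add: D open_Times)
  show ?thesis
    using smooth_on_snd[OF D smooth_on_directional[OF d(1) D \<phi>]]
      smooth_on_directional[OF directional_pd1 o assms]
    by (intro smooth_on_mult o)
qed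

lemma smooth_periodic_series_subst_deriv:
  assumes "smooth_periodic_series D m F"
  shows "smooth_periodic_series D (m - 1) (subst_deriv d \<phi> F)"
proof -
  have o: "open (UNIV \<times> D)" by (simp add: D open_Times)
  have F0: "fls_nth F n = 0" if "n < m" for n
    using assms that unfolding smooth_periodic_series_def by auto
  have F: "smooth_on (UNIV \<times> D) (fls_nth F n)" "p \<in> D \<Longrightarrow> periodic1 (\<lambda>y. fls_nth F n (y, p))" for n p
    using assms unfolding smooth_periodic_series_def by auto
  have nth: "fls_nth (subst_deriv d \<phi> F) n = (\<lambda>(y, p). slow d (fls_nth F n) (y, p)
      + (\<Sum>i=0..n+1-m. d (\<phi> (nat i)) p * pd1 (fls_nth F (n + 1 - i)) (y, p)))" for n
    by (rule subst_deriv_nth[where d = d, OF F0 d(3)])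
  have "fls_nth (subst_deriv d \<phi> F) n = 0" if "n < m - 1" for n
    using that by (simp add: nth F0 slow_0 d(3) fun_eq_iff)
  moreover have "smooth_on (UNIV \<times> D) (fls_nth (subst_deriv d \<phi> F) n)" for n
    unfolding nth
    unfolding case_prod_unfold prod.collapse
    by (intro smooth_on_add smooth_on_sum o smooth_on_directional[OF d(2) o F(1)]
        smooth_on_subst_deriv_term F(1))
  moreover have "periodic1 (\<lambda>y. fls_nth (subst_deriv d \<phi> F) n (y, p))" if "p \<in> D" for n p
    unfolding nth using that
    by (auto intro!: periodic1_intros periodic1_slow[OF d(1) D] periodic1_pd1 F)
  ultimately show ?thesis unfolding smooth_periodic_series_def by simp
qed

text \<open>
  The part \<open>\<epsilon>\<^sup>-\<^sup>1 (d \<phi>) \<partial>\<^sub>y\<close> of the substituted derivative averages to zero.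
\<close>

lemma avg_subst_deriv:
  assumes "smooth_periodic_series D m F" "p \<in> D"
  shows "avg (\<lambda>y. fls_nth (subst_deriv d \<phi> F) n (y, p)) = d (\<lambda>q. avg (\<lambda>y. fls_nth F n (y, q))) p"
proof -
  have o: "open (UNIV \<times> D)" by (simp add: D open_Times)
  have F0: "fls_nth F n = 0" if "n < m" for n
    using assms that unfolding smooth_periodic_series_def by auto
  have F: "smooth_on (UNIV \<times> D) (fls_nth F n)" "p \<in> D \<Longrightarrow> periodic1 (\<lambda>y. fls_nth F n (y, p))" for n p
    using assms unfolding smooth_periodic_series_def by auto
  have nth: "fls_nth (subst_deriv d \<phi> F) n = (\<lambda>(y, p). slow d (fls_nth F n) (y, p)
      + (\<Sum>i=0..n+1-m. d (\<phi> (nat i)) p * pd1 (fls_nth F (n + 1 - i)) (y, p)))" for n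
    by (rule subst_deriv_nth[where d = d, OF F0 d(3)])
  have c: "continuous_on UNIV (\<lambda>y. d (\<phi> j) p * pd1 (fls_nth F i) (y, p))" for i j
    using continuous_on_slice[OF smooth_on_subst_deriv_term[OF F(1)] assms(2)] by simp
  have "avg (\<lambda>y. fls_nth (subst_deriv d \<phi> F) n (y, p)) = avg (\<lambda>y. slow d (fls_nth F n) (y, p))
      + (\<Sum>i=0..n+1-m. d (\<phi> (nat i)) p * avg (\<lambda>y. pd1 (fls_nth F (n + 1 - i)) (y, p)))"
    unfolding nth case_prod_conv
    by (subst avg_add)
       (auto intro!: c continuous_on_sum continuous_on_slice[OF smooth_on_directional[OF d(2) o F(1)] assms(2)]
         simp: avg_sum avg_cmult c)
  also have "\<dots> = avg (\<lambda>y. slow d (fls_nth F n) (y, p))"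
    using avg_pd1_periodic[OF F(1) assms(2) F(2)[OF assms(2)]] by simp
  also have "\<dots> = d (\<lambda>q. avg (\<lambda>y. fls_nth F n (y, q))) p"
    by (rule directional_avg[OF d(1,2) D F(1) assms(2), symmetric])
  finally show ?thesis .
qed

end

lemma pd1_snd: "pd1 (\<lambda>z. h (snd z)) z = 0"
  by (simp add: pd1_def split: prod.split)

lemma slow_snd: "slow d (\<lambda>z. h (snd z)) z = d h (snd z)"
  by (simp add: slow_def split: prod.split)

section \<open>Coefficients of the residual for a smooth periodic expansion\<close>

locale modulated_expansion =
  fixes D :: "(real \<times> real) set"
    and u :: "nat \<Rightarrow> real \<times> real \<times> real \<Rightarrow> real" and \<phi> :: "nat \<Rightarrow> real \<times> real \<Rightarrow> real"
  assumes open_D: "open D"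
    and smooth_u: "\<And>j. smooth_on (UNIV \<times> D) (u j)"
    and periodic_u: "\<And>j p. p \<in> D \<Longrightarrow> periodic1 (\<lambda>y. u j (y, p))"
    and smooth_\<phi>: "\<And>j. smooth_on D (\<phi> j)"
begin

abbreviation w :: series where "w \<equiv> power_series u"
abbreviation DX :: "series \<Rightarrow> series" where "DX \<equiv> subst_deriv pd1 \<phi>"
abbreviation DT :: "series \<Rightarrow> series" where "DT \<equiv> subst_deriv pd2 \<phi>"
abbreviation \<kappa> :: "nat \<Rightarrow> real \<times> real \<Rightarrow> real" where "\<kappa> j \<equiv> pd1 (\<phi> j)"

lemma open_cylinder: "open (UNIV \<times> D)"
  by (simp add: open_D open_Times)

lemma smooth_pd1: "smooth_on (UNIV \<times> D) f \<Longrightarrow> smooth_on (UNIV \<times> D) (pd1 f)"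
  by (rule smooth_on_directional[OF directional_pd1 open_cylinder])

lemma smooth_pd1_funpow: "smooth_on (UNIV \<times> D) f \<Longrightarrow> smooth_on (UNIV \<times> D) ((pd1 ^^ n) f)"
  by (induction n) (auto intro: smooth_pd1)

lemma smooth_slow_pd1: "smooth_on (UNIV \<times> D) f \<Longrightarrow> smooth_on (UNIV \<times> D) (slow pd1 f)"
  by (rule smooth_on_directional[OF directional_slow_pd1 open_cylinder])

lemma smooth_\<kappa>: "smooth_on D (\<kappa> j)"
  by (rule smooth_on_directional[OF directional_pd1 open_D smooth_\<phi>])

lemma smooth_lift: "smooth_on D h \<Longrightarrow> smooth_on (UNIV \<times> D) (\<lambda>z :: real \<times> real \<times> real. h (snd z))"
  for h :: "real \<times> real \<Rightarrow> real"
  by (rule smooth_on_snd[OF open_D])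

lemma pd1_coeff_mult:
  assumes "smooth_on D h" "smooth_on (UNIV \<times> D) f" "z \<in> UNIV \<times> D"
  shows "pd1 (\<lambda>z. h (snd z) * f z) z = h (snd z) * pd1 f z"
  using directional_mult[OF directional_pd1 open_cylinder smooth_lift[OF assms(1)] assms(2,3)]
  by (simp add: pd1_snd)

lemma slow_pd1_coeff_mult:
  assumes "smooth_on D h" "smooth_on (UNIV \<times> D) f" "z \<in> UNIV \<times> D"
  shows "slow pd1 (\<lambda>z. h (snd z) * f z) z = pd1 h (snd z) * f z + h (snd z) * slow pd1 f z"
  using directional_mult[OF directional_slow_pd1 open_cylinder smooth_lift[OF assms(1)] assms(2,3)]
  by (simp add: slow_snd)

lemma pd1_slow_pd1_commute:
  assumes "smooth_on (UNIV \<times> D) f" "z \<in> UNIV \<times> D"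
  shows "pd1 (slow pd1 f) z = slow pd1 (pd1 f) z"
  by (rule directional_commute[OF directional_pd1 directional_slow_pd1 open_cylinder assms])

lemma series_w: "smooth_periodic_series D 0 w"
  using smooth_u periodic_u
  by (simp add: smooth_periodic_series_def power_series_nth zero_fun_def)

lemma series_DX:
  "smooth_periodic_series D m F \<Longrightarrow> smooth_periodic_series D (m - 1) (DX F)"
  by (rule smooth_periodic_series_subst_deriv[OF open_D directional_pd1 directional_slow_pd1 pd1_0 smooth_\<phi>])

lemma avg_DX:
  "smooth_periodic_series D m F \<Longrightarrow> p \<in> D \<Longrightarrow>
    avg (\<lambda>y. fls_nth (DX F) n (y, p)) = pd1 (\<lambda>q. avg (\<lambda>y. fls_nth F n (y, q))) p"
  by (rule avg_subst_deriv[OF open_D directional_pd1 directional_slow_pd1 pd1_0 smooth_\<phi>])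

lemma avg_DT:
  "smooth_periodic_series D m F \<Longrightarrow> p \<in> D \<Longrightarrow>
    avg (\<lambda>y. fls_nth (DT F) n (y, p)) = pd2 (\<lambda>q. avg (\<lambda>y. fls_nth F n (y, q))) p"
  by (rule avg_subst_deriv[OF open_D directional_pd2 directional_slow_pd2 pd2_0 smooth_\<phi>])

lemma series_DX_funpow: "smooth_periodic_series D (- int j) ((DX ^^ j) w)"
proof (induction j)
  case 0
  then show ?case using series_w by simp
next
  case (Suc j)
  have "- int (Suc j) = - int j - 1" by simp
  then show ?case using series_DX[OF Suc] by (simp only: funpow.simps o_apply)
qed

text \<open>The three lowest coefficients: the first two drive the recursion for iterated
  X-derivatives, and the third is needed for the nonlinear term at order \<epsilon>^1.\<close>

lemma subst_deriv_nth_leading: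
  assumes "\<And>n. n < m \<Longrightarrow> fls_nth F n = 0" "d 0 = 0"
  shows "fls_nth (subst_deriv d \<phi> F) (m - 1) z = d (\<phi> 0) (snd z) * pd1 (fls_nth F m) z"
    and "fls_nth (subst_deriv d \<phi> F) m z = slow d (fls_nth F m) z
      + d (\<phi> 0) (snd z) * pd1 (fls_nth F (m + 1)) z + d (\<phi> 1) (snd z) * pd1 (fls_nth F m) z"
    and "fls_nth (subst_deriv d \<phi> F) (m + 1) z = slow d (fls_nth F (m + 1)) z
      + d (\<phi> 0) (snd z) * pd1 (fls_nth F (m + 2)) z + d (\<phi> 1) (snd z) * pd1 (fls_nth F (m + 1)) z
      + d (\<phi> 2) (snd z) * pd1 (fls_nth F m) z"
proof -
  have I: "{0..1::int} = {0, 1}" "{0..2::int} = {0, 1, 2}" by auto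
  have s: "slow d (fls_nth F (m - 1)) = 0" using slow_0[of d] assms by simp
  note nth = subst_deriv_nth[where d = d and \<phi> = \<phi> and m = m and F = F, OF assms(1,2), simplified]
  show "fls_nth (subst_deriv d \<phi> F) (m - 1) z = d (\<phi> 0) (snd z) * pd1 (fls_nth F m) z"
    using s by (simp add: nth case_prod_unfold)
  show "fls_nth (subst_deriv d \<phi> F) m z = slow d (fls_nth F m) z
      + d (\<phi> 0) (snd z) * pd1 (fls_nth F (m + 1)) z + d (\<phi> 1) (snd z) * pd1 (fls_nth F m) z"
    by (simp add: nth case_prod_unfold I add.commute[of _ m])
  show "fls_nth (subst_deriv d \<phi> F) (m + 1) z = slow d (fls_nth F (m + 1)) z
      + d (\<phi> 0) (snd z) * pd1 (fls_nth F (m + 2)) z + d (\<phi> 1) (snd z) * pd1 (fls_nth F (m + 1)) z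
      + d (\<phi> 2) (snd z) * pd1 (fls_nth F m) z"
    by (simp add: nth case_prod_unfold I add.commute[of _ m])
qed

text \<open>The lowest order is reached only if every factor acts as \<open>\<kappa> 0\<close> times
  the y-derivative, on the leading coefficient \<open>u 0\<close>.\<close>

lemma DX_funpow_leading:
  "z \<in> UNIV \<times> D \<Longrightarrow> fls_nth ((DX ^^ j) w) (- int j) z = \<kappa> 0 (snd z) ^ j * (pd1 ^^ j) (u 0) z"
proof (induction j arbitrary: z)
  case 0
  then show ?case by (simp add: power_series_nth)
next
  case (Suc j)
  have z: "fls_nth ((DX ^^ j) w) n = 0" if "n < - int j" for n
    using series_DX_funpow[of j] that by (simp add: smooth_periodic_series_def)
  have sm: "smooth_on (UNIV \<times> D) (\<lambda>z. \<kappa> 0 (snd z) ^ j * (pd1 ^^ j) (u 0) z)"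
    by (intro smooth_on_intros smooth_lift[OF smooth_\<kappa>] smooth_pd1_funpow smooth_u open_cylinder)
  have "pd1 (fls_nth ((DX ^^ j) w) (- int j)) z = pd1 (\<lambda>z. \<kappa> 0 (snd z) ^ j * (pd1 ^^ j) (u 0) z) z"
    by (rule directional_cong[OF directional_pd1 open_cylinder sm Suc.IH Suc.prems])
  also have "\<dots> = \<kappa> 0 (snd z) ^ j * (pd1 ^^ Suc j) (u 0) z"
    using pd1_coeff_mult[OF smooth_on_power[OF open_D smooth_\<kappa>] smooth_pd1_funpow[OF smooth_u] Suc.prems]
    by simp
  moreover have i: "- int (Suc j) = - int j - 1" by simp
  ultimately show ?case
    using subst_deriv_nth_leading(1)[where d = pd1 and z = z and m = "- int j" and F = "(DX ^^ j) w",
        OF z pd1_0] i by (simp only: funpow.simps o_apply power_Suc mult.assoc)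
qed

text \<open>One order above the lowest, exactly one ingredient is not the leading one: a factor is
  the slow X-derivative, or a factor carries \<open>\<kappa> 1\<close>, or \<open>u 1\<close>
  replaces \<open>u 0\<close>. A slow derivative with r factors to its right differentiates
  \<open>\<kappa> 0\<close> to the power r, and summing r from 0 to i gives (i + 1) i / 2. For i =
  1, 2, 3 these are the constants 1, 3, 6 of \<open>corrector_rhs\<close>.\<close>

lemma DX_funpow_subleading:
  "z \<in> UNIV \<times> D \<Longrightarrow> fls_nth ((DX ^^ Suc i) w) (- int i) z =
     real (i + 1) * \<kappa> 0 (snd z) ^ i * slow pd1 ((pd1 ^^ i) (u 0)) z
     + real (i + 1) * real i / 2 * \<kappa> 0 (snd z) ^ (i - 1) * pd1 (\<kappa> 0) (snd z) * (pd1 ^^ i) (u 0) z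
     + \<kappa> 0 (snd z) ^ Suc i * (pd1 ^^ Suc i) (u 1) z
     + real (i + 1) * \<kappa> 0 (snd z) ^ i * \<kappa> 1 (snd z) * (pd1 ^^ Suc i) (u 0) z"
proof (induction i arbitrary: z)
  case 0
  have "fls_nth w n = 0" if "n < 0" for n using that by (simp add: power_series_nth)
  from subst_deriv_nth_leading(2)[where d = pd1 and z = z, OF this pd1_0] show ?case
    by (simp add: power_series_nth)
next
  case (Suc i)
  let ?j = "Suc i"
  have z: "fls_nth ((DX ^^ ?j) w) n = 0" if "n < - int ?j" for n
    using series_DX_funpow[of ?j] that unfolding smooth_periodic_series_def by blast
  let ?A = "\<lambda>z. \<kappa> 0 (snd z) ^ ?j * (pd1 ^^ ?j) (u 0) z"
  let ?b1 = "\<lambda>q. real (i + 1) * \<kappa> 0 q ^ i" and ?f1 = "slow pd1 ((pd1 ^^ i) (u 0))"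
  let ?b2 = "\<lambda>q. real (i + 1) * real i / 2 * \<kappa> 0 q ^ (i - 1) * pd1 (\<kappa> 0) q" and ?f2 = "(pd1 ^^ i) (u 0)"
  let ?b3 = "\<lambda>q. \<kappa> 0 q ^ Suc i" and ?f3 = "(pd1 ^^ Suc i) (u 1)"
  let ?b4 = "\<lambda>q. real (i + 1) * \<kappa> 0 q ^ i * \<kappa> 1 q" and ?f4 = "(pd1 ^^ Suc i) (u 0)"
  note sI = smooth_on_intros smooth_\<kappa> open_D smooth_on_directional[OF directional_pd1 open_D smooth_\<kappa>]
  have b: "smooth_on D ?b1" "smooth_on D ?b2" "smooth_on D ?b3" "smooth_on D ?b4"
    by (intro sI)+
  have f: "smooth_on (UNIV \<times> D) ?f1" "smooth_on (UNIV \<times> D) ?f2" "smooth_on (UNIV \<times> D) ?f3"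
    "smooth_on (UNIV \<times> D) ?f4"
    by (intro smooth_slow_pd1 smooth_pd1_funpow smooth_u)+
  note bf = b(1)[THEN smooth_lift, THEN smooth_on_mult[OF open_cylinder], OF f(1)]
    b(2)[THEN smooth_lift, THEN smooth_on_mult[OF open_cylinder], OF f(2)]
    b(3)[THEN smooth_lift, THEN smooth_on_mult[OF open_cylinder], OF f(3)]
    b(4)[THEN smooth_lift, THEN smooth_on_mult[OF open_cylinder], OF f(4)]
  note s2 = smooth_on_add[OF open_cylinder bf(1,2)]
  note s3 = smooth_on_add[OF open_cylinder s2 bf(3)]
  note s4 = smooth_on_add[OF open_cylinder s3 bf(4)]
  have smA: "smooth_on (UNIV \<times> D) ?A"
    by (intro smooth_on_intros smooth_lift[OF smooth_\<kappa>] smooth_pd1_funpow smooth_u open_cylinder)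
  note c = directional_cong[OF directional_pd1 open_cylinder] directional_cong[OF directional_slow_pd1 open_cylinder]
  have "pd1 (fls_nth ((DX ^^ ?j) w) (- int i)) z = pd1 (\<lambda>z. ?b1 (snd z) * ?f1 z + ?b2 (snd z) * ?f2 z
      + ?b3 (snd z) * ?f3 z + ?b4 (snd z) * ?f4 z) z"
    by (rule c(1)[OF s4 Suc.IH Suc.prems])
  also have "\<dots> = ?b1 (snd z) * pd1 ?f1 z + ?b2 (snd z) * pd1 ?f2 z
      + ?b3 (snd z) * pd1 ?f3 z + ?b4 (snd z) * pd1 ?f4 z"
    using directional_add[OF directional_pd1 open_cylinder s3 bf(4) Suc.prems]
      directional_add[OF directional_pd1 open_cylinder s2 bf(3) Suc.prems]
      directional_add[OF directional_pd1 open_cylinder bf(1,2) Suc.prems]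
      pd1_coeff_mult[OF b(1) f(1) Suc.prems] pd1_coeff_mult[OF b(2) f(2) Suc.prems]
      pd1_coeff_mult[OF b(3) f(3) Suc.prems] pd1_coeff_mult[OF b(4) f(4) Suc.prems]
    by argo
  also have "pd1 ?f1 z = slow pd1 ?f4 z"
    using pd1_slow_pd1_commute[OF f(2) Suc.prems] by simp
  finally have 1: "pd1 (fls_nth ((DX ^^ ?j) w) (- int i)) z = ?b1 (snd z) * slow pd1 ?f4 z
      + ?b2 (snd z) * ?f4 z + ?b3 (snd z) * pd1 ?f3 z + ?b4 (snd z) * pd1 ?f4 z"
    by simp
  have 2: "pd1 (fls_nth ((DX ^^ ?j) w) (- int ?j)) z = \<kappa> 0 (snd z) ^ ?j * pd1 ?f4 z"
    using c(1)[OF smA DX_funpow_leading Suc.prems]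
      pd1_coeff_mult[OF b(3) f(4) Suc.prems] by simp
  have 3: "slow pd1 (fls_nth ((DX ^^ ?j) w) (- int ?j)) z =
      real ?j * \<kappa> 0 (snd z) ^ i * pd1 (\<kappa> 0) (snd z) * ?f4 z + \<kappa> 0 (snd z) ^ ?j * slow pd1 ?f4 z"
  proof -
    have "snd z \<in> D" using Suc.prems by auto
    from directional_power[OF directional_pd1 open_D smooth_\<kappa> this, of 0 ?j]
    have "pd1 (\<lambda>q. \<kappa> 0 q ^ ?j) (snd z) = real ?j * \<kappa> 0 (snd z) ^ i * pd1 (\<kappa> 0) (snd z)"
      by (simp only: diff_Suc_1)
    then show ?thesis
      using c(2)[OF smA DX_funpow_leading Suc.prems] slow_pd1_coeff_mult[OF b(3) f(4) Suc.prems]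
      by (simp only:)
  qed
  have i: "- int ?j + 1 = - int i" by simp
  have "fls_nth ((DX ^^ Suc ?j) w) (- int ?j) z = slow pd1 (fls_nth ((DX ^^ ?j) w) (- int ?j)) z
      + \<kappa> 0 (snd z) * pd1 (fls_nth ((DX ^^ ?j) w) (- int i)) z
      + \<kappa> 1 (snd z) * pd1 (fls_nth ((DX ^^ ?j) w) (- int ?j)) z"
    using subst_deriv_nth_leading(2)[where d = pd1 and z = z and m = "- int ?j" and F = "(DX ^^ ?j) w",
        OF z pd1_0] i by (simp only: funpow.simps o_apply)
  also have "\<dots> = real (?j + 1) * \<kappa> 0 (snd z) ^ ?j * slow pd1 ?f4 z
     + real (?j + 1) * real ?j / 2 * \<kappa> 0 (snd z) ^ i * pd1 (\<kappa> 0) (snd z) * ?f4 z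
     + \<kappa> 0 (snd z) ^ Suc ?j * pd1 ?f3 z
     + real (?j + 1) * \<kappa> 0 (snd z) ^ ?j * \<kappa> 1 (snd z) * pd1 ?f4 z"
    \<comment> \<open>The split deals with the truncated exponent \<open>i - 1\<close>: for i = 0 it
      is 0, and the term vanishes through its factor \<open>real i\<close>.\<close>
    unfolding 1 2 3 by (cases i) (simp_all add: field_simps)
  finally show ?case by simp
qed

lemma w_nth: "n \<ge> 0 \<Longrightarrow> fls_nth w n = u (nat n)" "n < 0 \<Longrightarrow> fls_nth w n = 0"
  by (simp_all add: power_series_nth)

lemma w_nth_numeral: "fls_nth w 0 = u 0" "fls_nth w 1 = u 1" "fls_nth w 2 = u 2" "fls_nth w (- 1) = 0"
  by (simp_all add: power_series_nth)

lemmas slow_mult = directional_mult[OF directional_slow_pd1 open_cylinder]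
lemmas slow_power = directional_power[OF directional_slow_pd1 open_cylinder]
lemmas slow_cmult = directional_cmult[OF directional_slow_pd1 open_cylinder]
lemmas y_add = directional_add[OF directional_pd1 open_cylinder]
lemmas y_mult = directional_mult[OF directional_pd1 open_cylinder]
lemmas y_power = directional_power[OF directional_pd1 open_cylinder]
lemmas y_cmult = directional_cmult[OF directional_pd1 open_cylinder]

lemma w_times_DX_nth:
  "fls_nth (w * DX w) n z = (\<Sum>i=0..n+1. fls_nth w i z * fls_nth (DX w) (n - i) z)"
proof -
  have "fls_nth (DX w) n = 0" if "n < - 1" for n
    using series_DX[OF series_w] that by (simp add: smooth_periodic_series_def)
  from fls_times_nth_lower_bounds[where f = w and g = "DX w", OF w_nth(2) this]
  show ?thesis by (simp add: sum_apply_fun)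
qed

text \<open>Grouped by later use: the terms in \<open>u 1\<close> become the linearized operator
  once the T-derivative of \<open>\<phi> 0\<close> is \<Omega>; then come the two contributions of
  \<open>\<phi> 1\<close>; what depends on \<open>\<phi> 0\<close> and \<open>u 0\<close> alone is
  the right-hand side of the corrector equation.\<close>

lemma residual_order_0:
  assumes z: "z \<in> UNIV \<times> D"
  shows "fls_nth (residual \<delta> u \<phi>) 0 z =
    pd2 (\<phi> 0) (snd z) * pd1 (u 1) z
    + 6 * \<kappa> 0 (snd z) * (u 0 z * pd1 (u 1) z + pd1 (u 0) z * u 1 z)
    + \<kappa> 0 (snd z) ^ 3 * (pd1 ^^ 3) (u 1) z
    + \<delta> * (\<kappa> 0 (snd z) ^ 2 * (pd1 ^^ 2) (u 1) z + \<kappa> 0 (snd z) ^ 4 * (pd1 ^^ 4) (u 1) z)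
    + pd2 (\<phi> 1) (snd z) * pd1 (u 0) z
    + \<kappa> 1 (snd z) * (6 * u 0 z * pd1 (u 0) z + 3 * \<kappa> 0 (snd z) ^ 2 * (pd1 ^^ 3) (u 0) z
        + \<delta> * (2 * \<kappa> 0 (snd z) * (pd1 ^^ 2) (u 0) z + 4 * \<kappa> 0 (snd z) ^ 3 * (pd1 ^^ 4) (u 0) z))
    + corrector_rhs \<delta> (\<kappa> 0) (u 0) z"
proof -
  have DT0: "fls_nth (DT w) 0 z = slow pd2 (u 0) z
      + pd2 (\<phi> 0) (snd z) * pd1 (u 1) z + pd2 (\<phi> 1) (snd z) * pd1 (u 0) z"
    using subst_deriv_nth_leading(2)[where d = pd2 and m = 0 and F = w and z = z, OF w_nth(2) pd2_0]
    by (simp add: w_nth_numeral)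
  have DX0: "fls_nth (DX w) 0 z = slow pd1 (u 0) z
      + \<kappa> 0 (snd z) * pd1 (u 1) z + \<kappa> 1 (snd z) * pd1 (u 0) z"
    using subst_deriv_nth_leading(2)[where d = pd1 and m = 0 and F = w and z = z, OF w_nth(2) pd1_0]
    by (simp add: w_nth_numeral)
  have DX1: "fls_nth (DX w) (- 1) z = \<kappa> 0 (snd z) * pd1 (u 0) z"
    using subst_deriv_nth_leading(1)[where d = pd1 and m = 0 and F = w and z = z, OF w_nth(2) pd1_0]
    by (simp add: w_nth_numeral)
  have "{0..1::int} = {0, 1}" by auto
  then have prod: "fls_nth (w * DX w) 0 z = u 0 z * fls_nth (DX w) 0 z + u 1 z * fls_nth (DX w) (- 1) z"
    using w_times_DX_nth[of 0 z] by (simp add: w_nth_numeral)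
  have sq: "slow pd1 (\<lambda>z. 3 * (u 0 z)\<^sup>2) z = 6 * u 0 z * slow pd1 (u 0) z"
    using slow_cmult[OF smooth_on_power[OF open_cylinder smooth_u] z, of 3 0 2]
      slow_power[OF smooth_u z, of 0 2] by simp
  \<comment> \<open>The prefactors \<epsilon>, \<epsilon>^2, \<epsilon>^3 select orders -1, -2, -3
    of these powers, exactly the subleading ones.\<close>
  have eq: "(DX ^^ 2) w = (DX ^^ Suc 1) w" "(DX ^^ 3) w = (DX ^^ Suc 2) w" "(DX ^^ 4) w = (DX ^^ Suc 3) w"
    by (simp_all add: numeral_eq_Suc)
  have s: "Suc 2 = 3" "Suc 3 = 4" by simp_all
  note sub = DX_funpow_subleading[OF z, of 1, folded eq] DX_funpow_subleading[OF z, of 2, folded eq]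
    DX_funpow_subleading[OF z, of 3, folded eq]
  show ?thesis
    unfolding residual_nth Let_def prod DT0 DX0 DX1 corrector_rhs_def
    using sub sq by (cases z) (simp add: s field_simps numeral_2_eq_2[symmetric] flip: power2_eq_square)
qed

text \<open>The nonlinear term is the substituted X-derivative of w^2 / 2, and only the slow part of
  such a derivative survives averaging.\<close>

lemma avg_w_times_DX:
  assumes p: "p \<in> D"
  shows "avg (\<lambda>y. fls_nth (w * DX w) 1 (y, p)) = pd1 (\<lambda>q. avg (\<lambda>y. u 0 (y, q) * u 1 (y, q))) p"
    and "continuous_on UNIV (\<lambda>y. fls_nth (w * DX w) 1 (y, p))"
proof -
  \<comment> \<open>\<open>H\<close>, \<open>F\<close> and \<open>G\<close> are the coefficients of
    w^2 / 2 at orders 0, 1 and 2.\<close>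
  define F where "F = (\<lambda>z. u 0 z * u 1 z)"
  define G where "G = (\<lambda>z. u 0 z * u 2 z + 1/2 * u 1 z ^ 2)"
  define H where "H = (\<lambda>z. 1/2 * u 0 z ^ 2)"
  have sm: "smooth_on (UNIV \<times> D) F" "smooth_on (UNIV \<times> D) G" "smooth_on (UNIV \<times> D) H"
    unfolding F_def G_def H_def by (intro smooth_on_intros open_cylinder smooth_u)+
  have per: "periodic1 (\<lambda>y. F (y, p))" "periodic1 (\<lambda>y. G (y, p))" "periodic1 (\<lambda>y. H (y, p))"
    unfolding F_def G_def H_def power2_eq_square by (intro periodic1_intros periodic_u p)+
  have I: "{0..2::int} = {0, 1, 2}" by auto
  have eq: "fls_nth (w * DX w) 1 (y, p) = slow pd1 F (y, p)
      + (\<kappa> 0 p * pd1 G (y, p) + (\<kappa> 1 p * pd1 F (y, p) + \<kappa> 2 p * pd1 H (y, p)))" for y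
  proof -
    have z: "(y, p) \<in> UNIV \<times> D" using p by simp
    note lead = subst_deriv_nth_leading[where d = pd1 and m = 0 and F = w and z = "(y, p)",
        OF w_nth(2) pd1_0, simplified, unfolded w_nth_numeral]
    have 1: "fls_nth (w * DX w) 1 (y, p) = u 0 (y, p) * fls_nth (DX w) 1 (y, p)
        + u 1 (y, p) * fls_nth (DX w) 0 (y, p) + u 2 (y, p) * fls_nth (DX w) (- 1) (y, p)"
      using w_times_DX_nth[of 1 "(y, p)"] by (simp add: I w_nth_numeral)
    have 2: "slow pd1 F (y, p) = slow pd1 (u 0) (y, p) * u 1 (y, p) + u 0 (y, p) * slow pd1 (u 1) (y, p)"
      "pd1 F (y, p) = pd1 (u 0) (y, p) * u 1 (y, p) + u 0 (y, p) * pd1 (u 1) (y, p)"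
      unfolding F_def by (intro slow_mult y_mult smooth_u z)+
    have 3: "pd1 H (y, p) = u 0 (y, p) * pd1 (u 0) (y, p)"
      unfolding H_def
      using y_cmult[OF smooth_on_power[OF open_cylinder smooth_u[of 0]] z, of "1/2" 2]
        y_power[OF smooth_u[of 0] z, of 2] by simp
    have "pd1 G (y, p) = pd1 (\<lambda>z. u 0 z * u 2 z) (y, p) + pd1 (\<lambda>z. 1/2 * u 1 z ^ 2) (y, p)"
      unfolding G_def by (intro y_add smooth_on_intros open_cylinder smooth_u z)
    then have 4: "pd1 G (y, p) = pd1 (u 0) (y, p) * u 2 (y, p) + u 0 (y, p) * pd1 (u 2) (y, p)
        + u 1 (y, p) * pd1 (u 1) (y, p)"
      using y_mult[OF smooth_u[of 0] smooth_u[of 2] z]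
        y_cmult[OF smooth_on_power[OF open_cylinder smooth_u[of 1]] z, of "1/2" 2]
        y_power[OF smooth_u[of 1] z, of 2] by simp
    show ?thesis
      unfolding 1 2 3 4 using lead by (simp add: algebra_simps)
  qed
  have c: "continuous_on UNIV (\<lambda>y. pd1 F (y, p))" "continuous_on UNIV (\<lambda>y. pd1 G (y, p))"
    "continuous_on UNIV (\<lambda>y. pd1 H (y, p))" "continuous_on UNIV (\<lambda>y. slow pd1 F (y, p))"
    by (intro continuous_on_slice[OF _ p] smooth_pd1 smooth_slow_pd1 sm)+
  show "continuous_on UNIV (\<lambda>y. fls_nth (w * DX w) 1 (y, p))"
    unfolding eq by (intro continuous_intros c)
  have "avg (\<lambda>y. fls_nth (w * DX w) 1 (y, p)) = avg (\<lambda>y. slow pd1 F (y, p))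
      + (\<kappa> 0 p * avg (\<lambda>y. pd1 G (y, p)) + (\<kappa> 1 p * avg (\<lambda>y. pd1 F (y, p)) + \<kappa> 2 p * avg (\<lambda>y. pd1 H (y, p))))"
    unfolding eq avg_cmult[symmetric]
    by (intro avg_add[THEN trans] arg_cong2[where f = "(+)"] refl continuous_intros c)
  also have "\<dots> = avg (\<lambda>y. slow pd1 F (y, p))"
    using avg_pd1_periodic[OF sm(1) p per(1)] avg_pd1_periodic[OF sm(2) p per(2)]
      avg_pd1_periodic[OF sm(3) p per(3)] by simp
  also have "\<dots> = pd1 (\<lambda>q. avg (\<lambda>y. F (y, q))) p"
    by (rule directional_avg[OF directional_pd1 directional_slow_pd1 open_D sm(1) p, symmetric])
  finally show "avg (\<lambda>y. fls_nth (w * DX w) 1 (y, p)) = pd1 (\<lambda>q. avg (\<lambda>y. u 0 (y, q) * u 1 (y, q))) p"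
    by (simp add: F_def)
qed

text \<open>On averages each substituted X-derivative acts as the plain X-derivative at the same
  order, and \<open>w\<close> has no coefficients of negative order.\<close>

lemma avg_DX_funpow_eq_0:
  assumes "n < 0" "p \<in> D"
  shows "avg (\<lambda>y. fls_nth ((DX ^^ j) w) n (y, p)) = 0"
  using assms(2)
proof (induction j arbitrary: p)
  case 0
  then show ?case using assms(1) by (simp add: w_nth(2))
next
  case (Suc j)
  have "pd1 (\<lambda>q. avg (\<lambda>y. fls_nth ((DX ^^ j) w) n (y, q))) p = pd1 (\<lambda>q. 0) p"
    by (rule directional_cong[OF directional_pd1 open_D smooth_on_const Suc.IH Suc.prems])
  then show ?case
    using avg_DX[OF series_DX_funpow Suc.prems, of j n] directional_const[OF directional_pd1 Suc.prems]
    by simp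
qed

text \<open>The prefactors place the third, second and fourth derivatives at orders -1, 0 and -2.
  Only the second has a nonvanishing order-0 ancestor in \<open>w\<close>, which produces the
  diffusive term in the mean of \<open>u 0\<close>.\<close>

lemma avg_residual_order_1:
  assumes p: "p \<in> D"
  shows "avg (\<lambda>y. fls_nth (residual \<delta> u \<phi>) 1 (y, p)) =
    pd2 (\<lambda>q. avg (\<lambda>y. u 1 (y, q))) p + 6 * pd1 (\<lambda>q. avg (\<lambda>y. u 0 (y, q) * u 1 (y, q))) p
    + \<delta> * pd1 (pd1 (\<lambda>q. avg (\<lambda>y. u 0 (y, q)))) p"
proof -
  have cont: "continuous_on UNIV (\<lambda>y. fls_nth F n (y, p))" if "smooth_periodic_series D m F" for m F n
    using that continuous_on_slice[OF _ p] unfolding smooth_periodic_series_def by blast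
  have cDT: "continuous_on UNIV (\<lambda>y. fls_nth (DT w) n (y, p))" for n
    by (rule cont[OF smooth_periodic_series_subst_deriv[OF open_D directional_pd2 directional_slow_pd2
          pd2_0 smooth_\<phi> series_w]])
  note cDX = cont[OF series_DX_funpow]
  have "avg (\<lambda>y. fls_nth (residual \<delta> u \<phi>) 1 (y, p)) = avg (\<lambda>y. fls_nth (DT w) 1 (y, p))
      + 6 * avg (\<lambda>y. fls_nth (w * DX w) 1 (y, p)) + avg (\<lambda>y. fls_nth ((DX ^^ 3) w) (- 1) (y, p))
      + \<delta> * (avg (\<lambda>y. fls_nth ((DX ^^ 2) w) 0 (y, p)) + avg (\<lambda>y. fls_nth ((DX ^^ 4) w) (- 2) (y, p)))"
  proof -
    note c = cDT avg_w_times_DX(2)[OF p] cDX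
    show ?thesis
      unfolding residual_nth Let_def
      by (simp add: avg_add avg_cmult c continuous_on_add continuous_on_mult continuous_on_const)
  qed
  also have "avg (\<lambda>y. fls_nth ((DX ^^ 3) w) (- 1) (y, p)) = 0"
    by (rule avg_DX_funpow_eq_0[OF _ p]) simp
  also have "avg (\<lambda>y. fls_nth ((DX ^^ 4) w) (- 2) (y, p)) = 0"
    by (rule avg_DX_funpow_eq_0[OF _ p]) simp
  also have "avg (\<lambda>y. fls_nth (DT w) 1 (y, p)) = pd2 (\<lambda>q. avg (\<lambda>y. u 1 (y, q))) p"
    using avg_DT[OF series_w p, of 1] by (simp add: w_nth_numeral)
  also have "avg (\<lambda>y. fls_nth ((DX ^^ 2) w) 0 (y, p)) = pd1 (pd1 (\<lambda>q. avg (\<lambda>y. u 0 (y, q)))) p"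
  proof -
    have "avg (\<lambda>y. fls_nth ((DX ^^ 2) w) 0 (y, p)) = pd1 (\<lambda>q. avg (\<lambda>y. fls_nth (DX w) 0 (y, q))) p"
      using avg_DX[OF series_DX[OF series_w] p, of 0] by (simp add: numeral_2_eq_2)
    also have "\<dots> = pd1 (pd1 (\<lambda>q. avg (\<lambda>y. u 0 (y, q)))) p"
    proof (rule directional_cong[OF directional_pd1 open_D _ _ p])
      show "smooth_on D (pd1 (\<lambda>q. avg (\<lambda>y. u 0 (y, q))))"
        by (intro smooth_on_directional[OF directional_pd1 open_D] smooth_on_avg open_D smooth_u)
      show "avg (\<lambda>y. fls_nth (DX w) 0 (y, q)) = pd1 (\<lambda>q. avg (\<lambda>y. u 0 (y, q))) q" if "q \<in> D" for q
        using avg_DX[OF series_w that, of 0] by (simp add: w_nth_numeral)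
    qed
    finally show ?thesis .
  qed
  finally show ?thesis using avg_w_times_DX(1)[OF p] by simp
qed

end

section \<open>Travelling waves and the linearized operator\<close>

lemma deriv_funpow_slice: "(deriv ^^ n) (\<lambda>y. F (y, p)) = (\<lambda>y. (pd1 ^^ n) F (y, p))"
  by (induction n) (auto simp: pd1_def)

text \<open>The two slices may sit over different parameter spaces: it moves y-derivatives between
  \<open>u 0\<close> over (X,T) and \<open>U\<close> over (k,M).\<close>

lemma pd1_funpow_slice_eq:
  assumes "\<And>y. F (y, p) = G (y, q)"
  shows "(pd1 ^^ n) F (y, p) = (pd1 ^^ n) G (y, q)"
proof -
  have "(deriv ^^ n) (\<lambda>y. F (y, p)) = (deriv ^^ n) (\<lambda>y. G (y, q))" using assms by simp
  then show ?thesis unfolding deriv_funpow_slice by (rule fun_cong)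
qed

lemma slow_pd1_funpow_commute:
  fixes F :: "real \<times> real \<times> real \<Rightarrow> real"
  assumes "open S" "smooth_on S F" "z \<in> S"
  shows "slow pd1 ((pd1 ^^ n) F) z = (pd1 ^^ n) (slow pd1 F) z"
  using assms(3)
proof (induction n arbitrary: z)
  case (Suc n)
  have sm: "smooth_on S ((pd1 ^^ n) F)" for n
    by (induction n) (auto intro: assms smooth_on_directional[OF directional_pd1])
  have "slow pd1 ((pd1 ^^ Suc n) F) z = pd1 (slow pd1 ((pd1 ^^ n) F)) z"
    using directional_commute[OF directional_pd1 directional_slow_pd1 assms(1) sm Suc.prems] by simp
  also have "\<dots> = pd1 ((pd1 ^^ n) (slow pd1 F)) z"
    by (rule directional_cong[OF directional_pd1 assms(1) _ _ Suc.prems, symmetric])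
       (use Suc.IH in \<open>auto intro: smooth_on_directional[OF directional_slow_pd1] assms sm\<close>)
  finally show ?case by simp
qed simp

lemma higher_differentiable_on_DERIV:
  fixes f :: "real \<Rightarrow> real"
  assumes "higher_differentiable_on (Suc n) UNIV f"
  shows "(f has_real_derivative deriv f y) (at y)" "higher_differentiable_on n UNIV (deriv f)"
proof -
  have "(f has_derivative frechet_derivative f (at y)) (at y)" for y
    by (rule higher_differentiable_on_has_derivative[OF assms]) simp
  then have d: "(f has_real_derivative frechet_derivative f (at y) 1) (at y)" for y
    by (rule DERIV_along_curve[where \<gamma> = "\<lambda>s. s"]) (auto intro!: derivative_eq_intros)
  then have eq: "deriv f = (\<lambda>y. frechet_derivative f (at y) 1)"
    by (auto intro: DERIV_imp_deriv)
  show "(f has_real_derivative deriv f y) (at y)" using d by (simp add: eq)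
  show "higher_differentiable_on n UNIV (deriv f)" using assms by (simp add: eq)
qed

section \<open>Linearity of the operator on periodic functions of finite order\<close>

lemma deriv_funpow_linear:
  fixes f g :: "real \<Rightarrow> real"
  assumes "higher_differentiable_on n UNIV f" "higher_differentiable_on n UNIV g"
  shows "(deriv ^^ n) (\<lambda>y. a * f y + b * g y) = (\<lambda>y. a * (deriv ^^ n) f y + b * (deriv ^^ n) g y)"
  using assms
proof (induction n arbitrary: f g)
  case (Suc n)
  note f = higher_differentiable_on_DERIV[OF Suc.prems(1)]
    and g = higher_differentiable_on_DERIV[OF Suc.prems(2)]
  have "deriv (\<lambda>y. a * f y + b * g y) = (\<lambda>y. a * deriv f y + b * deriv g y)"
    by (rule ext, rule DERIV_imp_deriv) (auto intro!: derivative_eq_intros f(1) g(1))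
  then show ?case
    using Suc.IH[OF f(2) g(2)] by (simp only: funpow_Suc_right o_apply)
qed simp

lemma C_per_linear:
  assumes "f \<in> C_per n" "g \<in> C_per n"
  shows "(\<lambda>y. a * f y + b * g y) \<in> C_per n"
  using assms unfolding C_per_def
  by (auto simp: periodic1_def intro!: higher_differentiable_on_add higher_differentiable_on_mult
      higher_differentiable_on_const)

lemma C_per_mono: "f \<in> C_per n \<Longrightarrow> m \<le> n \<Longrightarrow> f \<in> C_per m"
  using dec_induct[of m n "\<lambda>k. higher_differentiable_on k UNIV f \<longrightarrow> higher_differentiable_on m UNIV f"]
    higher_differentiable_on_SucD unfolding C_per_def by blast

lemma C_per_continuous: "f \<in> C_per n \<Longrightarrow> continuous_on UNIV f"
  unfolding C_per_def using higher_differentiable_on_continuous by blast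

lemma C_per_slice:
  fixes F :: "real \<times> 'a::euclidean_space \<Rightarrow> real"
  assumes "smooth_on (UNIV \<times> D) F" "p \<in> D" "periodic1 (\<lambda>y. F (y, p))"
  shows "(\<lambda>y. F (y, p)) \<in> C_per n"
  using smooth_on_slice[OF assms(1,2)] assms(3) by (simp add: C_per_def smooth_on_def)

lemma lin_op_linear:
  assumes "f \<in> C_per 4" "g \<in> C_per 4"
    and "\<And>y. ((\<lambda>s. U (s, q)) has_real_derivative U' y) (at y)"
  shows "lin_op \<delta> U c q (\<lambda>y. a * f y + b * g y) y = a * lin_op \<delta> U c q f y + b * lin_op \<delta> U c q g y"
proof -
  obtain k M where q: "q = (k, M)" by (cases q)
  have hd: "higher_differentiable_on n UNIV f" "higher_differentiable_on n UNIV g" if "n \<le> 4" for n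
    using C_per_mono[OF assms(1) that] C_per_mono[OF assms(2) that] by (simp_all add: C_per_def)
  have d: "(f has_real_derivative deriv f y) (at y)" "(g has_real_derivative deriv g y) (at y)"
    using higher_differentiable_on_DERIV(1)[of 0] hd[of 1] by auto
  note L = deriv_funpow_linear[OF hd, of 2] deriv_funpow_linear[OF hd, of 3]
    deriv_funpow_linear[OF hd, of 4]
  have 1: "deriv (\<lambda>s. (6 * U (s, k, M) - c (k, M)) * h s) y
      = 6 * U' y * h y + (6 * U (y, k, M) - c (k, M)) * h'"
    if "(h has_real_derivative h') (at y)" for h h'
    using assms(3)[of y] unfolding q
    by (intro DERIV_imp_deriv) (auto intro!: derivative_eq_intros that)
  have 2: "((\<lambda>y. a * f y + b * g y) has_real_derivative a * deriv f y + b * deriv g y) (at y)"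
    by (auto intro!: derivative_eq_intros d)
  show ?thesis
    unfolding q lin_op_def case_prod_conv 1[OF d(1)] 1[OF d(2)] 1[OF 2]
    using L by (simp add: algebra_simps)
qed

section \<open>Parameter derivatives of the wave family\<close>

locale travelling_wave =
  fixes \<delta> :: real and P :: "(real \<times> real) set"
    and U :: "real \<times> real \<times> real \<Rightarrow> real" and c :: "real \<times> real \<Rightarrow> real"
  assumes family: "travelling_wave_family \<delta> P U c"
begin

definition \<Omega> :: "real \<times> real \<Rightarrow> real" where "\<Omega> = (\<lambda>(k, M). - k * c (k, M))"
definition Q :: "real \<times> real \<Rightarrow> real" where "Q = (\<lambda>(k, M). avg (\<lambda>y. 3 * (U (y, k, M))\<^sup>2))"
abbreviation Uk :: "real \<times> real \<times> real \<Rightarrow> real" where "Uk \<equiv> slow pd1 U"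

lemma open_P: "open P" and smooth_U: "smooth_on (UNIV \<times> P) U" and smooth_c: "smooth_on P c"
  using family unfolding travelling_wave_family_def by auto

lemma wave:
  assumes "(k, M) \<in> P"
  shows "k > 0 \<and> periodic1 (\<lambda>y. U (y, k, M)) \<and> \<not> (\<lambda>y. U (y, k, M)) constant_on UNIV \<and>
    avg (\<lambda>y. U (y, k, M)) = M \<and>
    (\<forall>y. - k * c (k, M) * deriv (\<lambda>y. U (y, k, M)) y + 6 * k * U (y, k, M) * deriv (\<lambda>y. U (y, k, M)) y
      + k ^ 3 * (deriv ^^ 3) (\<lambda>y. U (y, k, M)) y
      + \<delta> * (k ^ 2 * (deriv ^^ 2) (\<lambda>y. U (y, k, M)) y + k ^ 4 * (deriv ^^ 4) (\<lambda>y. U (y, k, M)) y) = 0)"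
  using family assms unfolding travelling_wave_family_def Let_def by fast

lemma k_pos: "q \<in> P \<Longrightarrow> fst q > 0"
  and periodic_U: "q \<in> P \<Longrightarrow> periodic1 (\<lambda>y. U (y, q))"
  and nonconstant_U: "q \<in> P \<Longrightarrow> \<not> (\<lambda>y. U (y, q)) constant_on UNIV"
  and avg_U: "q \<in> P \<Longrightarrow> avg (\<lambda>y. U (y, q)) = snd q"
  using wave[of "fst q" "snd q"] by simp_all

lemma open_UP: "open (UNIV \<times> P)"
  by (simp add: open_P open_Times)

lemma smooth_\<Omega>: "smooth_on P \<Omega>"
  unfolding \<Omega>_def case_prod_unfold prod.collapse
  by (intro smooth_on_intros open_P smooth_c smooth_on_bounded_linear bounded_linear_fst)

lemma smooth_Uk: "smooth_on (UNIV \<times> P) Uk"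
  by (rule smooth_on_directional[OF directional_slow_pd1 open_UP smooth_U])

lemma wave_equation:
  assumes "(k, M) \<in> P"
  shows "\<Omega> (k, M) * pd1 U (y, k, M) + 6 * k * U (y, k, M) * pd1 U (y, k, M)
    + k ^ 3 * (pd1 ^^ 3) U (y, k, M)
    + \<delta> * (k ^ 2 * (pd1 ^^ 2) U (y, k, M) + k ^ 4 * (pd1 ^^ 4) U (y, k, M)) = 0"
proof -
  have "deriv (\<lambda>y. U (y, k, M)) = (\<lambda>y. pd1 U (y, k, M))"
    using deriv_funpow_slice[of 1 U "(k, M)"] by simp
  then show ?thesis
    using wave[OF assms] unfolding deriv_funpow_slice \<Omega>_def by simp
qed

lemma eventually_fst: "(k, M) \<in> P \<Longrightarrow> eventually (\<lambda>s. (s, M) \<in> P) (nhds k)"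
  and eventually_snd: "(k, M) \<in> P \<Longrightarrow> eventually (\<lambda>s. (k, s) \<in> P) (nhds M)"
proof -
  have "open ((\<lambda>s. (s, M)) -` P)" "open ((\<lambda>s. (k, s)) -` P)"
    by (intro open_vimage open_P continuous_intros)+
  then show "(k, M) \<in> P \<Longrightarrow> eventually (\<lambda>s. (s, M) \<in> P) (nhds k)"
    "(k, M) \<in> P \<Longrightarrow> eventually (\<lambda>s. (k, s) \<in> P) (nhds M)"
    unfolding eventually_nhds by auto
qed

text \<open>The left-hand side collects the terms in which the k-derivative falls on the profile,
  the right-hand side those in which it falls on a coefficient. Apart from the \<Omega> term, the
  latter form the same bracket that multiplies \<open>\<kappa> 1\<close> in
  \<open>residual_order_0\<close>: a perturbation of the wave number acts on the coefficients like a
  k-derivative.\<close>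

lemma wave_equation_deriv_k:
  fixes k M y :: real
  assumes "(k, M) \<in> P"
  defines "z \<equiv> (y, k, M)"
  shows "\<Omega> (k, M) * pd1 Uk z + 6 * k * (pd1 U z * Uk z + U z * pd1 Uk z) + k ^ 3 * (pd1 ^^ 3) Uk z
      + \<delta> * (k ^ 2 * (pd1 ^^ 2) Uk z + k ^ 4 * (pd1 ^^ 4) Uk z)
    = - (pd1 \<Omega> (k, M) * pd1 U z + (6 * U z * pd1 U z + 3 * k ^ 2 * (pd1 ^^ 3) U z
      + \<delta> * (2 * k * (pd1 ^^ 2) U z + 4 * k ^ 3 * (pd1 ^^ 4) U z)))"
proof -
  have smU: "smooth_on (UNIV \<times> P) ((pd1 ^^ n) U)" for n
    by (induction n) (auto intro: smooth_U open_UP smooth_on_directional[OF directional_pd1])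
  have "((\<lambda>s. (pd1 ^^ n) U (y, s, M)) has_real_derivative slow pd1 ((pd1 ^^ n) U) z) (at k)" for n
  proof -
    have "smooth_on P (\<lambda>q. (pd1 ^^ n) U (y, q))"
      by (rule smooth_on_Pair_compose[OF open_P _ _ _ smU[of n]])
         (use open_P in \<open>auto intro: smooth_on_bounded_linear bounded_linear_intros\<close>)
    from DERIV_pd1[OF this assms(1)] directionalD[OF directional_pd1 this assms(1)]
    show ?thesis by (simp add: slow_def z_def)
  qed
  \<comment> \<open>Parameter and y-derivatives commute, so everything is expressed through
    y-derivatives of \<open>Uk\<close>.\<close>
  then have dU: "((\<lambda>s. (pd1 ^^ n) U (y, s, M)) has_real_derivative (pd1 ^^ n) Uk z) (at k)" for n
    using slow_pd1_funpow_commute[OF open_UP smooth_U, of z n] assms(1) by (metis UNIV_I mem_Sigma_iff z_def)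
  note dU = dU[of 0, simplified] dU[of 1, simplified] dU[of 2] dU[of 3] dU[of 4]
  have d\<Omega>: "((\<lambda>s. \<Omega> (s, M)) has_real_derivative pd1 \<Omega> (k, M)) (at k)"
    using DERIV_pd1[OF smooth_\<Omega> assms(1)] directionalD[OF directional_pd1 smooth_\<Omega> assms(1)] by simp
  \<comment> \<open>\<open>E\<close> is the profile equation at fixed y and M as a function of k
    alone. It vanishes near k because \<open>P\<close> is open, so its derivative is 0.\<close>
  define E where "E = (\<lambda>s. \<Omega> (s, M) * pd1 U (y, s, M) + 6 * s * U (y, s, M) * pd1 U (y, s, M)
    + s ^ 3 * (pd1 ^^ 3) U (y, s, M)
    + \<delta> * (s ^ 2 * (pd1 ^^ 2) U (y, s, M) + s ^ 4 * (pd1 ^^ 4) U (y, s, M)))"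
  have "(E has_real_derivative pd1 \<Omega> (k, M) * pd1 U z + \<Omega> (k, M) * pd1 Uk z
      + (6 * U z * pd1 U z + 6 * k * (pd1 U z * Uk z + U z * pd1 Uk z))
      + (3 * k ^ 2 * (pd1 ^^ 3) U z + k ^ 3 * (pd1 ^^ 3) Uk z)
      + \<delta> * (2 * k * (pd1 ^^ 2) U z + k ^ 2 * (pd1 ^^ 2) Uk z
        + (4 * k ^ 3 * (pd1 ^^ 4) U z + k ^ 4 * (pd1 ^^ 4) Uk z))) (at k)"
    unfolding E_def
    by (rule derivative_eq_intros dU d\<Omega> refl)+ (simp add: z_def algebra_simps)
  moreover have "(E has_real_derivative 0) (at k)"
  proof -
    have "eventually (\<lambda>s. E s = 0) (nhds k)"
      using eventually_fst[OF assms(1)] by eventually_elim (simp add: E_def wave_equation)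
    then show ?thesis using DERIV_cong_ev[of k k E "\<lambda>_. 0" 0 0] by simp
  qed
  ultimately have "pd1 \<Omega> (k, M) * pd1 U z + \<Omega> (k, M) * pd1 Uk z
      + (6 * U z * pd1 U z + 6 * k * (pd1 U z * Uk z + U z * pd1 Uk z))
      + (3 * k ^ 2 * (pd1 ^^ 3) U z + k ^ 3 * (pd1 ^^ 3) Uk z)
      + \<delta> * (2 * k * (pd1 ^^ 2) U z + k ^ 2 * (pd1 ^^ 2) Uk z
        + (4 * k ^ 3 * (pd1 ^^ 4) U z + k ^ 4 * (pd1 ^^ 4) Uk z)) = 0"
    by (rule DERIV_unique)
  then show ?thesis unfolding eq_neg_iff_add_eq_0 by (simp add: algebra_simps)
qed

lemma slow_pd2_U:
  assumes "(k, M) \<in> P"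
  shows "slow pd2 U (y, k, M) = 1"
proof -
  obtain U0 where U0: "\<And>k M y. (k, M) \<in> P \<Longrightarrow> U (y, k, M) = M + U0 y k"
    using family unfolding travelling_wave_family_def by fast
  have "eventually (\<lambda>s. U (y, k, s) = s + U0 y k) (nhds M)"
    using eventually_snd[OF assms] by eventually_elim (rule U0)
  then have "((\<lambda>s. U (y, k, s)) has_real_derivative 1) (at M)"
    by (subst DERIV_cong_ev) (auto intro!: derivative_eq_intros)
  then show ?thesis by (simp add: slow_def pd2_def DERIV_imp_deriv)
qed

text \<open>From c = 6 M + c_0(k). With the unit M-derivative of the profile it lets shifts of the
  mean be rewritten as M-derivatives of \<Omega> and \<open>Q\<close>.\<close>

lemma pd2_\<Omega>:
  assumes "(k, M) \<in> P"
  shows "pd2 \<Omega> (k, M) = - 6 * k"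
proof -
  obtain c0 where c0: "\<And>k M. (k, M) \<in> P \<Longrightarrow> c (k, M) = 6 * M + c0 k"
    using family unfolding travelling_wave_family_def by fast
  have "eventually (\<lambda>s. \<Omega> (k, s) = - k * (6 * s + c0 k)) (nhds M)"
    using eventually_snd[OF assms] by eventually_elim (simp add: \<Omega>_def c0)
  then have "((\<lambda>s. \<Omega> (k, s)) has_real_derivative - 6 * k) (at M)"
    by (subst DERIV_cong_ev) (auto intro!: derivative_eq_intros)
  then show ?thesis by (simp add: pd2_def DERIV_imp_deriv)
qed

text \<open>The constraint <U> = M holds for every k, so its k-derivative vanishes.\<close>

lemma avg_Uk:
  assumes "q \<in> P"
  shows "avg (\<lambda>y. Uk (y, q)) = 0"
proof -
  have "avg (\<lambda>y. Uk (y, q)) = pd1 (\<lambda>q. avg (\<lambda>y. U (y, q))) q"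
    by (rule directional_avg[OF directional_pd1 directional_slow_pd1 open_P smooth_U assms, symmetric])
  also have "\<dots> = pd1 snd q"
    by (rule directional_cong[OF directional_pd1 open_P _ avg_U assms])
       (simp add: open_P smooth_on_bounded_linear bounded_linear_snd)
  also have "\<dots> = 0" by (simp add: pd1_def split: prod.split)
  finally show ?thesis .
qed

lemma Q_alt: "Q = (\<lambda>q. avg (\<lambda>y. 3 * U (y, q) ^ 2))"
  by (auto simp: Q_def)

lemma smooth_U_square: "smooth_on (UNIV \<times> P) (\<lambda>z. 3 * U z ^ 2)"
  by (intro smooth_on_intros open_UP smooth_U)

lemma smooth_Q: "smooth_on P Q"
  unfolding Q_alt by (rule smooth_on_avg[OF open_P smooth_U_square])

lemma directional_U_square:
  assumes "directional (UNIV \<times> P) d v" "z \<in> UNIV \<times> P"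
  shows "d (\<lambda>z. 3 * U z ^ 2) z = 6 * (U z * d U z)"
  using directional_cmult[OF assms(1) open_UP smooth_on_power[OF open_UP smooth_U] assms(2), of 3 2]
    directional_power[OF assms(1) open_UP smooth_U assms(2), of 2] by simp

lemma pd1_Q:
  assumes "q \<in> P"
  shows "pd1 Q q = 6 * avg (\<lambda>y. U (y, q) * Uk (y, q))"
  unfolding Q_alt avg_cmult[symmetric]
  using directional_avg[OF directional_pd1 directional_slow_pd1 open_P smooth_U_square assms]
    directional_U_square[OF directional_slow_pd1] assms by (simp add: avg_cmult)

lemma pd2_Q:
  assumes "q \<in> P"
  shows "pd2 Q q = 6 * snd q"
proof -
  have "pd2 Q q = avg (\<lambda>y. 6 * (U (y, q) * slow pd2 U (y, q)))"
    unfolding Q_alt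
    using directional_avg[OF directional_pd2 directional_slow_pd2 open_P smooth_U_square assms]
      directional_U_square[OF directional_slow_pd2] assms by simp
  also have "\<dots> = 6 * avg (\<lambda>y. U (y, q))"
    using slow_pd2_U[of "fst q" "snd q"] assms by (simp add: avg_cmult)
  finally show ?thesis using avg_U[OF assms] by simp
qed

end

section \<open>The corrector and the modulation equations\<close>

locale modulated_wave = modulated_expansion D u \<phi> + travelling_wave \<delta> P U c
  for D u \<phi> \<delta> P U c +
  assumes standing: "standing_assumption \<delta> P U c"
    and K_in_P: "\<And>p. p \<in> D \<Longrightarrow> (pd1 (\<phi> 0) p, avg (\<lambda>y. u 0 (y, p))) \<in> P"
    and u0: "\<And>y p. p \<in> D \<Longrightarrow> u 0 (y, p) = U (y, pd1 (\<phi> 0) p, avg (\<lambda>y. u 0 (y, p)))"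
    and phase: "\<And>p. p \<in> D \<Longrightarrow> pd2 (\<phi> 0) p = \<Omega> (pd1 (\<phi> 0) p, avg (\<lambda>y. u 0 (y, p)))"
    and order_0: "holds_at_order D \<delta> u \<phi> 0"
    and order_1: "holds_at_order D \<delta> u \<phi> 1"
begin

definition M0 :: "real \<times> real \<Rightarrow> real" where "M0 = (\<lambda>p. avg (\<lambda>y. u 0 (y, p)))"
definition M1 :: "real \<times> real \<Rightarrow> real" where "M1 = (\<lambda>p. avg (\<lambda>y. u 1 (y, p)))"

abbreviation K :: "real \<times> real \<Rightarrow> real \<times> real" where "K p \<equiv> (\<kappa> 0 p, M0 p)"
abbreviation L :: "real \<times> real \<Rightarrow> (real \<Rightarrow> real) \<Rightarrow> real \<Rightarrow> real" where "L p \<equiv> lin_op \<delta> U c (K p)"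
text \<open>The k-derivative of the coefficients of the profile equation at a fixed profile, without
  the contribution of \<Omega>.\<close>

abbreviation A where "A z \<equiv> 6 * u 0 z * pd1 (u 0) z + 3 * \<kappa> 0 (snd z) ^ 2 * (pd1 ^^ 3) (u 0) z
  + \<delta> * (2 * \<kappa> 0 (snd z) * (pd1 ^^ 2) (u 0) z + 4 * \<kappa> 0 (snd z) ^ 3 * (pd1 ^^ 4) (u 0) z)"

text \<open>The k-derivative of the profile, evaluated along the modulated parameters and regarded
  as a function of (y;X,T).\<close>

definition G :: "real \<times> real \<times> real \<Rightarrow> real" where "G = (\<lambda>z. Uk (fst z, K (snd z)))"

lemma K: "p \<in> D \<Longrightarrow> K p \<in> P"
  using K_in_P by (simp add: M0_def)

lemma u0_eq: "p \<in> D \<Longrightarrow> u 0 (y, p) = U (y, K p)"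
  unfolding M0_def by (rule u0)

lemma k0_pos: "p \<in> D \<Longrightarrow> \<kappa> 0 p > 0"
  using k_pos[OF K] by simp

lemma smooth_M0: "smooth_on D M0" and smooth_M1: "smooth_on D M1"
  unfolding M0_def M1_def by (intro smooth_on_avg open_D smooth_u)+

lemma smooth_compose_K:
  fixes h :: "real \<times> real \<Rightarrow> real"
  assumes "smooth_on P h"
  shows "smooth_on D (\<lambda>p. h (K p))"
  by (rule smooth_on_Pair_compose[OF open_D _ _ _ assms]) (auto intro: K smooth_\<kappa> smooth_M0)

lemma smooth_G: "smooth_on (UNIV \<times> D) G"
  unfolding G_def
proof (rule smooth_on_Pair_compose[OF open_cylinder _ _ _ smooth_Uk])
  show "smooth_on (UNIV \<times> D) (\<lambda>z :: real \<times> real \<times> real. fst z \<bullet> i)" if "i \<in> Basis" for i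
    using that by (auto intro!: smooth_on_bounded_linear bounded_linear_fst open_cylinder)
  show "smooth_on (UNIV \<times> D) (\<lambda>z :: real \<times> real \<times> real. K (snd z) \<bullet> i)" if "i \<in> Basis" for i
    using that by (auto simp: Basis_prod_def intro!: smooth_lift smooth_\<kappa> smooth_M0)
qed (use K in auto)

lemma pd1_funpow_u0: "p \<in> D \<Longrightarrow> (pd1 ^^ n) (u 0) (y, p) = (pd1 ^^ n) U (y, K p)"
  by (rule pd1_funpow_slice_eq) (rule u0_eq)

lemma pd1_u0: "p \<in> D \<Longrightarrow> pd1 (u 0) (y, p) = pd1 U (y, K p)"
  using pd1_funpow_u0[of p 1] by simp

lemma pd1_funpow_G: "(pd1 ^^ n) G (y, p) = (pd1 ^^ n) Uk (y, K p)"
  by (rule pd1_funpow_slice_eq) (simp add: G_def)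

lemma periodic_G: "p \<in> D \<Longrightarrow> periodic1 (\<lambda>y. G (y, p))"
  unfolding G_def using periodic1_slow[OF directional_pd1 open_P smooth_U periodic_U K] by simp

lemma DERIV_U: "p \<in> D \<Longrightarrow> ((\<lambda>y. U (y, K p)) has_real_derivative pd1 (u 0) (y, p)) (at y)"
  using DERIV_slice[OF smooth_U K] pd1_u0 by simp

section \<open>The linearized operator along the modulated wave\<close>

lemma lin_op_slice:
  assumes F: "smooth_on (UNIV \<times> D) F" and p: "p \<in> D"
  shows "L p (\<lambda>y. F (y, p)) y = \<Omega> (K p) * pd1 F (y, p)
    + 6 * \<kappa> 0 p * (u 0 (y, p) * pd1 F (y, p) + pd1 (u 0) (y, p) * F (y, p))
    + \<kappa> 0 p ^ 3 * (pd1 ^^ 3) F (y, p)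
    + \<delta> * (\<kappa> 0 p ^ 2 * (pd1 ^^ 2) F (y, p) + \<kappa> 0 p ^ 4 * (pd1 ^^ 4) F (y, p))"
proof -
  have "deriv (\<lambda>s. (6 * U (s, K p) - c (K p)) * F (s, p)) y =
      6 * pd1 (u 0) (y, p) * F (y, p) + (6 * U (y, K p) - c (K p)) * pd1 F (y, p)"
    by (rule DERIV_imp_deriv) (auto intro!: derivative_eq_intros DERIV_U DERIV_slice F p)
  then show ?thesis
    unfolding lin_op_def case_prod_conv deriv_funpow_slice \<Omega>_def
    by (simp add: u0_eq[OF p] ring_distribs)
qed

lemma lin_op_u1:
  assumes p: "p \<in> D"
  shows "L p (\<lambda>y. u 1 (y, p)) y = - (pd2 (\<phi> 1) p * pd1 (u 0) (y, p) + \<kappa> 1 p * A (y, p)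
    + corrector_rhs \<delta> (\<kappa> 0) (u 0) (y, p))"
proof -
  have "fls_nth (residual \<delta> u \<phi>) 0 (y, p) = 0"
    using order_0 p by (simp add: holds_at_order_def)
  moreover have "pd2 (\<phi> 0) p = \<Omega> (K p)" using phase[OF p] by (simp add: M0_def)
  ultimately show ?thesis
    using residual_order_0[of "(y, p)" \<delta>] lin_op_slice[OF smooth_u p, of 1 y] p
    by simp
qed

lemma lin_op_G:
  assumes p: "p \<in> D"
  shows "L p (\<lambda>y. G (y, p)) y = - (pd1 \<Omega> (K p) * pd1 (u 0) (y, p) + A (y, p))"
  using lin_op_slice[OF smooth_G p, of y] wave_equation_deriv_k[OF K[OF p], of y]
    pd1_funpow_G[of 0 y p] pd1_funpow_G[of 1 y p] pd1_funpow_G[of 2 y p] pd1_funpow_G[of 3 y p]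
    pd1_funpow_G[of 4 y p] pd1_u0[OF p, of y] u0_eq[OF p, of y] pd1_funpow_u0[OF p, of 2 y]
    pd1_funpow_u0[OF p, of 3 y] pd1_funpow_u0[OF p, of 4 y]
  by (simp add: algebra_simps)

text \<open>The counterpart of \<open>lin_op_G\<close> for M: the M-derivative of the profile is 1,
  and 6 k is minus the M-derivative of \<Omega>.\<close>

lemma lin_op_1:
  assumes p: "p \<in> D"
  shows "L p (\<lambda>y. 1) y = 6 * \<kappa> 0 p * pd1 (u 0) (y, p)"
proof -
  have "(pd1 ^^ Suc n) (\<lambda>_ :: real \<times> real \<times> real. 1) = (\<lambda>_. 0)" for n
    by (induction n) (auto simp: pd1_def)
  from this[of 0] this[of 1] this[of 2] this[of 3] show ?thesis
    using lin_op_slice[OF smooth_on_const p, of 1 y] by (simp add: numeral_eq_Suc)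
qed

lemma kernel: "p \<in> D \<Longrightarrow> kernel_on (C_per 4) (L p) = span1 (\<lambda>y. pd1 (u 0) (y, p))"
proof -
  assume p: "p \<in> D"
  have "deriv (\<lambda>y. U (y, K p)) = (\<lambda>y. pd1 (u 0) (y, p))"
    using DERIV_U[OF p] by (auto intro: DERIV_imp_deriv)
  moreover have "\<And>k M. (k, M) \<in> P \<Longrightarrow>
      kernel_on (C_per 4) (lin_op \<delta> U c (k, M)) = span1 (deriv (\<lambda>y. U (y, k, M)))"
    using standing unfolding standing_assumption_def Let_def by fast
  ultimately show ?thesis using K[OF p] by simp
qed

lemma lin_op_pd1_u0:
  assumes p: "p \<in> D"
  shows "L p (\<lambda>y. pd1 (u 0) (y, p)) y = 0"
proof -
  have "(\<lambda>y. pd1 (u 0) (y, p)) \<in> span1 (\<lambda>y. pd1 (u 0) (y, p))"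
    unfolding span1_def by (auto intro: exI[of _ 1])
  then show ?thesis using kernel[OF p] by (auto simp: kernel_on_def)
qed

section \<open>Construction and uniqueness of the corrector\<close>

definition N :: "real \<times> real \<Rightarrow> real" where
  "N = (\<lambda>p. avg (\<lambda>y. pd1 (u 0) (y, p) * pd1 (u 0) (y, p)))"

lemma smooth_N: "smooth_on D N"
  unfolding N_def by (intro smooth_on_avg smooth_on_mult smooth_pd1 smooth_u open_D open_cylinder)

lemma N_pos:
  assumes "p \<in> D"
  shows "N p > 0"
  unfolding N_def
  by (rule avg_deriv_square_pos[OF DERIV_U[OF assms] _ periodic_U[OF K[OF assms]]
        nonconstant_U[OF K[OF assms]]])
     (rule continuous_on_slice[OF smooth_pd1[OF smooth_u] assms])

text \<open>
  Order \<open>\<epsilon>\<^sup>0\<close> says that \<open>L u\<^sub>1 = - (\<partial>\<^sub>T\<phi>\<^sub>1 U' + k\<^sub>1 A + rhs)\<close>, and the \<open>k\<close>-derivative of the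
  profile equation that \<open>L \<partial>\<^sub>kU = - (\<partial>\<^sub>k\<Omega> U' + A)\<close>.  As \<open>L 1 = 6 k U'\<close>, the function
  \<open>k\<^sub>1 \<partial>\<^sub>kU - u\<^sub>1 - b\<close> solves the corrector equation.
\<close>

definition b :: "real \<times> real \<Rightarrow> real" where
  "b = (\<lambda>p. (pd2 (\<phi> 1) p - \<kappa> 1 p * pd1 \<Omega> (K p)) / (6 * \<kappa> 0 p))"
definition g :: "real \<times> real \<times> real \<Rightarrow> real" where
  "g = (\<lambda>z. \<kappa> 1 (snd z) * G z - u 1 z - b (snd z))"
text \<open>The coefficient of the orthogonal projection of \<open>g\<close> onto U'. Subtracting
  this multiple enforces the normalization and leaves the equation intact, as U' lies in the
  kernel.\<close>

definition a :: "real \<times> real \<Rightarrow> real" where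
  "a = (\<lambda>p. avg (\<lambda>y. g (y, p) * pd1 (u 0) (y, p)) / N p)"
definition fstar :: "real \<times> real \<times> real \<Rightarrow> real" where
  "fstar = (\<lambda>z. g z - a (snd z) * pd1 (u 0) z)"

lemma smooth_b: "smooth_on D b"
proof -
  have s: "smooth_on D (\<lambda>p. 6 * \<kappa> 0 p)" "smooth_on D (pd2 (\<phi> 1))" "smooth_on D (\<lambda>p. pd1 \<Omega> (K p))"
    by (intro smooth_on_intros smooth_\<kappa> open_D smooth_compose_K smooth_\<Omega> open_P smooth_\<phi>
        smooth_on_directional[OF directional_pd1] smooth_on_directional[OF directional_pd2])+
  show ?thesis
    unfolding b_def
    by (intro smooth_on_divide smooth_on_diff smooth_on_mult s smooth_\<kappa> open_D) (use k0_pos in force)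
qed

lemma smooth_g: "smooth_on (UNIV \<times> D) g"
  unfolding g_def
  by (intro smooth_on_intros smooth_lift smooth_\<kappa> smooth_G smooth_u smooth_b open_cylinder)

lemma smooth_a: "smooth_on D a"
  unfolding a_def
  by (intro smooth_on_divide smooth_on_avg smooth_on_mult smooth_g smooth_pd1 smooth_u open_D
      open_cylinder smooth_N) (use N_pos in force)

lemma smooth_fstar: "smooth_on (UNIV \<times> D) fstar"
  unfolding fstar_def
  by (intro smooth_on_intros smooth_lift smooth_a smooth_g smooth_pd1 smooth_u open_cylinder)

lemma is_corrector_fstar:
  assumes p: "p \<in> D"
  shows "is_corrector \<delta> U c (\<kappa> 0) M0 (u 0) p (\<lambda>y. fstar (y, p))"
proof -
  have per: "periodic1 (\<lambda>y. pd1 (u 0) (y, p))" by (rule periodic1_pd1[OF periodic_u[OF p]])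
  have C: "(\<lambda>y. G (y, p)) \<in> C_per 4" "(\<lambda>y. u 1 (y, p)) \<in> C_per 4"
    "(\<lambda>y. pd1 (u 0) (y, p)) \<in> C_per 4" "(\<lambda>y. 1) \<in> C_per 4"
    using C_per_slice[OF smooth_G p periodic_G[OF p]] C_per_slice[OF smooth_u p periodic_u[OF p]]
      C_per_slice[OF smooth_pd1[OF smooth_u] p per] C_per_slice[OF smooth_on_const p]
    by simp_all
  \<comment> \<open>Nested binary combinations, the shape required by \<open>C_per_linear\<close>
    and \<open>lin_op_linear\<close>.\<close>
  have eq: "(\<lambda>y. fstar (y, p)) = (\<lambda>y. 1 * (\<kappa> 1 p * G (y, p) + (- 1) * u 1 (y, p))
      + (- 1) * (b p * 1 + a p * pd1 (u 0) (y, p)))"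
    by (auto simp: fstar_def g_def)
  note C2 = C_per_linear[OF C(1,2), of "\<kappa> 1 p" "- 1"] C_per_linear[OF C(4,3), of "b p" "a p"]
  have "(\<lambda>y. fstar (y, p)) \<in> C_per 4"
    unfolding eq by (rule C_per_linear[OF C2])
  moreover have "avg (\<lambda>y. fstar (y, p) * pd1 U (y, K p)) = 0"
  proof -
    have "avg (\<lambda>y. fstar (y, p) * pd1 U (y, K p)) = avg (\<lambda>y. g (y, p) * pd1 (u 0) (y, p)
        - a p * (pd1 (u 0) (y, p) * pd1 (u 0) (y, p)))"
      by (simp add: fstar_def pd1_u0[OF p] algebra_simps)
    also have "\<dots> = avg (\<lambda>y. g (y, p) * pd1 (u 0) (y, p))
        - avg (\<lambda>y. a p * (pd1 (u 0) (y, p) * pd1 (u 0) (y, p)))"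
      by (intro avg_diff continuous_intros continuous_on_slice[OF _ p] smooth_g smooth_pd1 smooth_u)
    also have "\<dots> = avg (\<lambda>y. g (y, p) * pd1 (u 0) (y, p)) - a p * N p"
      unfolding avg_cmult N_def ..
    also have "\<dots> = 0"
      using N_pos[OF p] by (simp add: a_def)
    finally show ?thesis .
  qed
  moreover have "L p (\<lambda>y. fstar (y, p)) y = corrector_rhs \<delta> (\<kappa> 0) (u 0) (y, p)" for y
  proof -
    note lin = lin_op_linear[OF _ _ DERIV_U[OF p]]
    have "L p (\<lambda>y. fstar (y, p)) y =
        \<kappa> 1 p * L p (\<lambda>y. G (y, p)) y - L p (\<lambda>y. u 1 (y, p)) y
        - b p * L p (\<lambda>y. 1) y - a p * L p (\<lambda>y. pd1 (u 0) (y, p)) y"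
      unfolding eq lin[OF C2] lin[OF C(1,2)] lin[OF C(4,3)] by simp
    \<comment> \<open>The divisor \<open>6 * \<kappa> 0 p\<close> in \<open>b\<close> cancels the
      factor in L 1. What remains removes the U' terms left over from L u_1 and L G.\<close>
    also have "b p * L p (\<lambda>y. 1) y = (pd2 (\<phi> 1) p - \<kappa> 1 p * pd1 \<Omega> (K p)) * pd1 (u 0) (y, p)"
      unfolding lin_op_1[OF p] b_def using k0_pos[OF p] by simp
    finally show ?thesis
      unfolding lin_op_G[OF p] lin_op_u1[OF p] lin_op_pd1_u0[OF p] by (simp add: algebra_simps)
  qed
  ultimately show ?thesis by (simp add: is_corrector_def)
qed

text \<open>The difference of two correctors lies in the kernel, hence is \<alpha> U'. Orthogonality
  to U' gives \<alpha> \<open>N p\<close> = 0, and \<open>N p\<close> is positive.\<close>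

lemma is_corrector_unique:
  assumes p: "p \<in> D" and f: "is_corrector \<delta> U c (\<kappa> 0) M0 (u 0) p f"
    and h: "is_corrector \<delta> U c (\<kappa> 0) M0 (u 0) p h"
  shows "f = h"
proof -
  note f = f[unfolded is_corrector_def] and h = h[unfolded is_corrector_def]
  have C: "f \<in> C_per 4" "h \<in> C_per 4" using f h by auto
  let ?d = "\<lambda>y. 1 * f y + (- 1) * h y"
  have "L p ?d y = 0" for y
    using lin_op_linear[OF C DERIV_U[OF p], of \<delta> c 1 "- 1" y] f h by simp
  then have "?d \<in> kernel_on (C_per 4) (L p)"
    using C_per_linear[OF C, of 1 "- 1"] by (simp add: kernel_on_def)
  then obtain \<alpha> where \<alpha>: "?d = (\<lambda>y. \<alpha> * pd1 (u 0) (y, p))"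
    unfolding kernel[OF p] span1_def by auto
  have cont: "continuous_on UNIV (\<lambda>y. pd1 U (y, K p))"
    using continuous_on_slice[OF smooth_pd1[OF smooth_u[of 0]] p] pd1_u0[OF p] by simp
  have "\<alpha> * N p = avg (\<lambda>y. ?d y * pd1 U (y, K p))"
    unfolding fun_cong[OF \<alpha>] N_def avg_cmult[symmetric] by (simp add: pd1_u0[OF p] mult.assoc)
  also have "\<dots> = avg (\<lambda>y. f y * pd1 U (y, K p) - h y * pd1 U (y, K p))"
    by (simp add: algebra_simps)
  also have "\<dots> = avg (\<lambda>y. f y * pd1 U (y, K p)) - avg (\<lambda>y. h y * pd1 U (y, K p))"
    by (intro avg_diff continuous_on_mult cont C_per_continuous[OF C(1)] C_per_continuous[OF C(2)])
  also have "\<dots> = 0" using f h by simp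
  finally have "\<alpha> = 0" using N_pos[OF p] by simp
  then show ?thesis using \<alpha> by (simp add: fun_eq_iff)
qed

section \<open>Modulation equations for an arbitrary choice of correctors\<close>

context
  fixes f0 :: "real \<times> real \<times> real \<Rightarrow> real"
  assumes f0: "\<And>p. p \<in> D \<Longrightarrow> is_corrector \<delta> U c (\<kappa> 0) M0 (u 0) p (\<lambda>y. f0 (y, p))"
begin

lemma f0_eq: "p \<in> D \<Longrightarrow> f0 (y, p) = fstar (y, p)"
  using is_corrector_unique[OF _ f0 is_corrector_fstar] by meson

text \<open>The function is only given as a corrector at each point of \<open>D\<close>; joint
  smoothness is inherited from \<open>fstar\<close> by uniqueness.\<close>

lemma smooth_f0: "smooth_on (UNIV \<times> D) f0"
  by (rule smooth_on_cong[OF open_cylinder smooth_fstar]) (use f0_eq in auto)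

definition m :: "real \<times> real \<Rightarrow> real" where "m = (\<lambda>p. avg (\<lambda>y. f0 (y, p)))"

lemma smooth_m: "smooth_on D m"
  unfolding m_def by (rule smooth_on_avg[OF open_D smooth_f0])

lemma u1_eq: "p \<in> D \<Longrightarrow> u 1 (y, p) = \<kappa> 1 p * G (y, p) - b p - f0 (y, p) - a p * pd1 (u 0) (y, p)"
  by (simp add: f0_eq fstar_def g_def)

text \<open>Applied with v = 1, to find \<open>b\<close>, and with v = \<open>u 0\<close>, to find
  the flux.\<close>

lemma u1_avg_terms:
  assumes p: "p \<in> D" and v: "continuous_on UNIV v"
  shows "avg (\<lambda>y. v y * u 1 (y, p)) = \<kappa> 1 p * avg (\<lambda>y. v y * G (y, p)) - b p * avg v
    - avg (\<lambda>y. v y * f0 (y, p)) - a p * avg (\<lambda>y. v y * pd1 (u 0) (y, p))"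
proof -
  have "avg (\<lambda>y. v y * u 1 (y, p)) = avg (\<lambda>y. \<kappa> 1 p * (v y * G (y, p)) - b p * v y
      - v y * f0 (y, p) - a p * (v y * pd1 (u 0) (y, p)))"
    unfolding u1_eq[OF p] by (simp add: algebra_simps)
  also have "\<dots> = avg (\<lambda>y. \<kappa> 1 p * (v y * G (y, p))) - avg (\<lambda>y. b p * v y)
    - avg (\<lambda>y. v y * f0 (y, p)) - avg (\<lambda>y. a p * (v y * pd1 (u 0) (y, p)))"
    by (intro avg_diff[THEN trans] arg_cong2[where f = "(-)"] refl continuous_intros v
        continuous_on_slice[OF _ p] smooth_G smooth_f0 smooth_pd1 smooth_u)
  finally show ?thesis by (simp add: avg_cmult)
qed

lemma avg_G: "p \<in> D \<Longrightarrow> avg (\<lambda>y. G (y, p)) = 0"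
  using avg_Uk[OF K] by (simp add: G_def)

text \<open>Both the k-derivative of the profile and U' have mean zero, so averaging leaves only
  \<open>b\<close> and the mean of f_0.\<close>

lemma b_eq: "p \<in> D \<Longrightarrow> b p = - (M1 p + m p)"
  using u1_avg_terms[of p "\<lambda>_. 1"] avg_G avg_pd1_periodic[OF smooth_u _ periodic_u]
  by (simp add: M1_def m_def)

text \<open>The definition of \<open>b\<close> solved for the T-derivative of
  \<open>\<phi> 1\<close>: the linearized relation between frequency and wave parameters, corrected
  by the mean of f_0.\<close>

lemma phase_1:
  assumes p: "p \<in> D"
  shows "pd2 (\<phi> 1) p = (\<kappa> 1 p * pd1 \<Omega> (K p) + M1 p * pd2 \<Omega> (K p)) - 6 * \<kappa> 0 p * m p"
proof -
  have "pd2 (\<phi> 1) p - \<kappa> 1 p * pd1 \<Omega> (K p) = 6 * \<kappa> 0 p * b p"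
    unfolding b_def using k0_pos[OF p] by simp
  then show ?thesis
    unfolding b_eq[OF p] pd2_\<Omega>[OF K[OF p]] by (simp add: algebra_simps)
qed

lemma first_modulation_equation:
  assumes p: "p \<in> D"
  shows "pd2 (\<kappa> 1) p - pd1 (\<lambda>q. \<kappa> 1 q * pd1 \<Omega> (K q) + M1 q * pd2 \<Omega> (K q)) p
    = - pd1 (\<lambda>q. 6 * \<kappa> 0 q * avg (\<lambda>y. f0 (y, q))) p"
proof -
  have s1: "smooth_on D (\<lambda>q. \<kappa> 1 q * pd1 \<Omega> (K q) + M1 q * pd2 \<Omega> (K q))"
    by (intro smooth_on_add smooth_on_mult open_D smooth_\<kappa> smooth_M1
        smooth_compose_K[OF smooth_on_directional[OF directional_pd1 open_P smooth_\<Omega>]]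
        smooth_compose_K[OF smooth_on_directional[OF directional_pd2 open_P smooth_\<Omega>]])
  have s2: "smooth_on D (\<lambda>q. 6 * \<kappa> 0 q * m q)"
    by (intro smooth_on_intros open_D smooth_\<kappa> smooth_m)
  have "pd2 (\<kappa> 1) p = pd1 (pd2 (\<phi> 1)) p"
    by (rule directional_commute[OF directional_pd2 directional_pd1 open_D smooth_\<phi> p])
  also have "\<dots> = pd1 (\<lambda>q. (\<kappa> 1 q * pd1 \<Omega> (K q) + M1 q * pd2 \<Omega> (K q)) - 6 * \<kappa> 0 q * m q) p"
    by (rule directional_cong[OF directional_pd1 open_D smooth_on_diff[OF open_D s1 s2] phase_1 p])
  also have "\<dots> = pd1 (\<lambda>q. \<kappa> 1 q * pd1 \<Omega> (K q) + M1 q * pd2 \<Omega> (K q)) p - pd1 (\<lambda>q. 6 * \<kappa> 0 q * m q) p"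
    by (rule directional_diff[OF directional_pd1 open_D s1 s2 p])
  finally show ?thesis by (simp add: m_def)
qed

text \<open>The k-derivative term gives the k-derivative of \<open>Q\<close>. Since -
  \<open>b\<close> = M_1 + <f_0> and the M-derivative of \<open>Q\<close> is 6 M_0, the constant
  gives the M_1 term together with 6 M_0 <f_0>, which turns f_0 into f_0 - <f_0>.\<close>

lemma avg_u0_u1:
  assumes p: "p \<in> D"
  shows "6 * avg (\<lambda>y. u 0 (y, p) * u 1 (y, p)) = (\<kappa> 1 p * pd1 Q (K p) + M1 p * pd2 Q (K p))
    - avg (\<lambda>y. 6 * u 0 (y, p) * (f0 (y, p) - m p))"
proof -
  have c0: "continuous_on UNIV (\<lambda>y. u 0 (y, p))" by (rule continuous_on_slice[OF smooth_u p])
  \<comment> \<open>u_0 u_0' is the y-derivative of the periodic function u_0^2 / 2, so the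
    undetermined phase shift \<open>a\<close> drops out.\<close>
  have half: "avg (\<lambda>y. u 0 (y, p) * pd1 (u 0) (y, p)) = 0"
  proof -
    have "pd1 (\<lambda>z. 1/2 * u 0 z ^ 2) (y, p) = u 0 (y, p) * pd1 (u 0) (y, p)" for y
      using y_cmult[OF smooth_on_power[OF open_cylinder smooth_u[of 0]], of "(y, p)" "1/2" 2]
        y_power[OF smooth_u[of 0], of "(y, p)" 2] p by simp
    moreover have "avg (\<lambda>y. pd1 (\<lambda>z. 1/2 * u 0 z ^ 2) (y, p)) = 0"
      using periodic_u[OF p, of 0]
      by (intro avg_pd1_periodic[OF _ p] smooth_on_intros open_cylinder smooth_u) (simp add: periodic1_def)
    ultimately show ?thesis by simp
  qed
  have UG: "6 * avg (\<lambda>y. u 0 (y, p) * G (y, p)) = pd1 Q (K p)"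
    using pd1_Q[OF K[OF p]] by (simp add: G_def u0_eq[OF p])
  have "avg (\<lambda>y. 6 * u 0 (y, p) * (f0 (y, p) - m p))
      = avg (\<lambda>y. 6 * (u 0 (y, p) * f0 (y, p)) - 6 * m p * u 0 (y, p))"
    by (simp add: algebra_simps)
  also have "\<dots> = avg (\<lambda>y. 6 * (u 0 (y, p) * f0 (y, p))) - avg (\<lambda>y. 6 * m p * u 0 (y, p))"
    by (intro avg_diff continuous_intros c0 continuous_on_slice[OF smooth_f0 p])
  also have "\<dots> = 6 * avg (\<lambda>y. u 0 (y, p) * f0 (y, p)) - 6 * m p * M0 p"
    by (simp add: avg_cmult M0_def)
  finally show ?thesis
    unfolding u1_avg_terms[OF p c0] half pd2_Q[OF K[OF p]] b_eq[OF p] UG[symmetric]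
    by (simp add: M0_def algebra_simps)
qed

lemma second_modulation_equation:
  assumes p: "p \<in> D"
  shows "pd2 M1 p + pd1 (\<lambda>q. \<kappa> 1 q * pd1 Q (K q) + M1 q * pd2 Q (K q)) p
    = pd1 (\<lambda>q. avg (\<lambda>y. 6 * u 0 (y, q) * (f0 (y, q) - avg (\<lambda>s. f0 (s, q))))) p
      - \<delta> * pd1 (pd1 M0) p"
proof -
  let ?R = "\<lambda>q. avg (\<lambda>y. 6 * u 0 (y, q) * (f0 (y, q) - m q))"
  let ?B = "\<lambda>q. avg (\<lambda>y. u 0 (y, q) * u 1 (y, q))"
  have s1: "smooth_on D (\<lambda>q. \<kappa> 1 q * pd1 Q (K q) + M1 q * pd2 Q (K q))"
    by (intro smooth_on_add smooth_on_mult open_D smooth_\<kappa> smooth_M1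
        smooth_compose_K[OF smooth_on_directional[OF directional_pd1 open_P smooth_Q]]
        smooth_compose_K[OF smooth_on_directional[OF directional_pd2 open_P smooth_Q]])
  have "smooth_on (UNIV \<times> D) (\<lambda>z. 6 * u 0 z * (f0 z - m (snd z)))"
    by (intro smooth_on_intros open_cylinder smooth_u smooth_f0 smooth_lift smooth_m)
  from smooth_on_avg[OF open_D this] have s2: "smooth_on D ?R" by simp
  have sB: "smooth_on D ?B"
    by (intro smooth_on_avg smooth_on_mult open_D open_cylinder smooth_u)
  \<comment> \<open>The formula for the flux holds throughout the open set \<open>D\<close>, which
    allows it to be differentiated in X.\<close>
  have "pd1 (\<lambda>q. 6 * ?B q) p = pd1 (\<lambda>q. (\<kappa> 1 q * pd1 Q (K q) + M1 q * pd2 Q (K q)) - ?R q) p"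
    by (rule directional_cong[OF directional_pd1 open_D smooth_on_diff[OF open_D s1 s2] avg_u0_u1 p])
  then have 1: "6 * pd1 ?B p = pd1 (\<lambda>q. \<kappa> 1 q * pd1 Q (K q) + M1 q * pd2 Q (K q)) p - pd1 ?R p"
    unfolding directional_cmult[OF directional_pd1 open_D sB p]
      directional_diff[OF directional_pd1 open_D s1 s2 p] .
  have "(\<lambda>y. fls_nth (residual \<delta> u \<phi>) 1 (y, p)) = (\<lambda>_. 0)"
    using order_1 p by (simp add: holds_at_order_def)
  then have "pd2 M1 p + 6 * pd1 ?B p + \<delta> * pd1 (pd1 M0) p = 0"
    using avg_residual_order_1[OF p, of \<delta>] by (simp add: M0_def M1_def)
  with 1 show ?thesis by (simp add: m_def)
qed

end

end

theorem mainTheorem3: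
  fixes \<delta> :: real
    and P D :: "(real \<times> real) set"
    and U :: "real \<times> real \<times> real \<Rightarrow> real" and c :: "real \<times> real \<Rightarrow> real"
    and u :: "nat \<Rightarrow> real \<times> real \<times> real \<Rightarrow> real" and \<phi> :: "nat \<Rightarrow> real \<times> real \<Rightarrow> real"
    and k0 M0 k1 M1 \<Omega> Q :: "real \<times> real \<Rightarrow> real"
  assumes "\<delta> > 0"
    and "travelling_wave_family \<delta> P U c"
    and "standing_assumption \<delta> P U c"
    and "open D"
    and "\<And>j. smooth_on (UNIV \<times> D) (u j)"
    and "\<And>j p. p \<in> D \<Longrightarrow> periodic1 (\<lambda>y. u j (y, p))"
    and "\<And>j. smooth_on D (\<phi> j)"
    and k0: "k0 = pd1 (\<phi> 0)" and M0: "M0 = (\<lambda>p. avg (\<lambda>y. u 0 (y, p)))"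
    and k1: "k1 = pd1 (\<phi> 1)" and M1: "M1 = (\<lambda>p. avg (\<lambda>y. u 1 (y, p)))"
    and \<Omega>: "\<Omega> = (\<lambda>(k, M). - k * c (k, M))"
    and Q: "Q = (\<lambda>(k, M). avg (\<lambda>y. 3 * (U (y, k, M))\<^sup>2))"
    and "\<And>p. p \<in> D \<Longrightarrow> (k0 p, M0 p) \<in> P"
    and "\<And>y p. p \<in> D \<Longrightarrow> u 0 (y, p) = U (y, k0 p, M0 p)"
    and "\<And>p. p \<in> D \<Longrightarrow> pd2 (\<phi> 0) p = \<Omega> (k0 p, M0 p)"
    and "holds_at_order D \<delta> u \<phi> 0"
    and "holds_at_order D \<delta> u \<phi> 1"
  shows "(\<forall>p\<in>D. \<exists>!f. is_corrector \<delta> U c k0 M0 (u 0) p f) \<and>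
    (\<forall>f0. (\<forall>p\<in>D. is_corrector \<delta> U c k0 M0 (u 0) p (\<lambda>y. f0 (y, p))) \<longrightarrow>
       smooth_on (UNIV \<times> D) f0 \<and>
       (\<forall>p\<in>D.
          pd2 k1 p
            - pd1 (\<lambda>q. k1 q * pd1 \<Omega> (k0 q, M0 q) + M1 q * pd2 \<Omega> (k0 q, M0 q)) p
          = - pd1 (\<lambda>q. 6 * k0 q * avg (\<lambda>y. f0 (y, q))) p \<and>
          pd2 M1 p
            + pd1 (\<lambda>q. k1 q * pd1 Q (k0 q, M0 q) + M1 q * pd2 Q (k0 q, M0 q)) p
          = pd1 (\<lambda>q. avg (\<lambda>y. 6 * u 0 (y, q) * (f0 (y, q) - avg (\<lambda>s. f0 (s, q))))) p
            - \<delta> * pd1 (pd1 M0) p))"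
proof -
  interpret tw: travelling_wave \<delta> P U c by unfold_locales fact
  have \<Omega>_eq: "\<Omega> = tw.\<Omega>" and Q_eq: "Q = tw.Q" by (simp_all add: \<Omega> Q tw.\<Omega>_def tw.Q_def)
  interpret mw: modulated_wave D u \<phi> \<delta> P U c
    using assms(3-7,14-18) unfolding k0 M0 \<Omega>_eq by unfold_locales
  have M0_eq: "M0 = mw.M0" and M1_eq: "M1 = mw.M1" by (simp_all add: M0 M1 mw.M0_def mw.M1_def)
  show ?thesis
    unfolding k0 k1 M0_eq M1_eq \<Omega>_eq Q_eq
  proof (intro conjI ballI allI impI)
    fix p assume "p \<in> D"
    then show "\<exists>!f. is_corrector \<delta> U c (pd1 (\<phi> 0)) mw.M0 (u 0) p f"
      using mw.is_corrector_fstar mw.is_corrector_unique by blast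
  next
    fix f0 assume "\<forall>p\<in>D. is_corrector \<delta> U c (pd1 (\<phi> 0)) mw.M0 (u 0) p (\<lambda>y. f0 (y, p))"
    then have f0: "is_corrector \<delta> U c (pd1 (\<phi> 0)) mw.M0 (u 0) p (\<lambda>y. f0 (y, p))" if "p \<in> D" for p
      using that by blast
    show "smooth_on (UNIV \<times> D) f0"
      by (rule mw.smooth_f0[OF f0])
    fix p assume p: "p \<in> D"
    show "pd2 (pd1 (\<phi> 1)) p
        - pd1 (\<lambda>q. pd1 (\<phi> 1) q * pd1 tw.\<Omega> (pd1 (\<phi> 0) q, mw.M0 q)
            + mw.M1 q * pd2 tw.\<Omega> (pd1 (\<phi> 0) q, mw.M0 q)) p
      = - pd1 (\<lambda>q. 6 * pd1 (\<phi> 0) q * avg (\<lambda>y. f0 (y, q))) p"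
      by (rule mw.first_modulation_equation[OF f0 p])
    show "pd2 mw.M1 p
        + pd1 (\<lambda>q. pd1 (\<phi> 1) q * pd1 tw.Q (pd1 (\<phi> 0) q, mw.M0 q)
            + mw.M1 q * pd2 tw.Q (pd1 (\<phi> 0) q, mw.M0 q)) p
      = pd1 (\<lambda>q. avg (\<lambda>y. 6 * u 0 (y, q) * (f0 (y, q) - avg (\<lambda>s. f0 (s, q))))) p
        - \<delta> * pd1 (pd1 mw.M0) p"
      by (rule mw.second_modulation_equation[OF f0 p])
  qed
qed

end
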